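(* Let $(X,\Sigma,\mu)$ be a localizable measure space, let $\nu$ be a positive measure on $(X,\Sigma)$, and set $M=L^\infty(X,\Sigma,\mu)$. The following are equivalent: (i) There exists a measurable $h:X\to[0,\infty]$ with $\nu(E)=\int_E h\,d\mu$ for all $E\in\Sigma$. (ii) $\nu\ll\mu$ and $\nu$ has $\mu$-support. (iii) $\nu\ll\mu$ and $\nu$ is $\mu$-semifinite. (iv) $\nu\ll\mu$ and $\psi_\nu$ is a normal weight on $M_+$. Moreover, every normal weight on $M_+$ is of the form $\psi_\nu$ for a measure $\nu$ as in (i). The function $h$ in (i) is unique up to $\mu$-a.e. equality. Finally, if the equivalent conditions (i)--(iv) hold, then $\mu\ll\nu$ if and only if $h$ in (i) may be chosen to be strictly positive.
   Context: All measures are positive. $L^\infty(X,\Sigma,\mu)$ is the commutative $C^*$-algebra of essentially bounded complex measurable functions modulo $\mu$-a.e. equality; its projections are the classes $[\chi_E]$, $E\in\Sigma$, and they form a lattice. A measure is semifinite if every set of infinite measure contains a measurable subset of strictly positive finite measure. $(X,\Sigma,\mu)$ is Dedekind if every increasing net of projections of $L^\infty(X,\Sigma,\mu)$ has a supremum in the lattice of projections; it is localizable if it is semifinite and Dedekind. $\nu\ll\mu$ means $\nu(E)=0$ whenever $\mu(E)=0$. $\nu$ has $\mu$-support if there is $E_0\in\Sigma$ with $\nu(E)=\nu(E\cap E_0)$ for all $E\in\Sigma$ and $\nu(E)>0$ for all $E\in\Sigma$ with $E\subset E_0$ and $\mu(E)>0$. $\nu$ is $\mu$-semifinite if whenever $\nu(E)>0$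 there is a measurable $F\subset E$ with $\mu(F)<\infty$ and $\nu(F)>0$. A weight on a $C^*$-algebra $N$ is an additive map $\omega:N_+\to[0,\infty]$ with $\omega(tx)=t\omega(x)$ for $t\in[0,\infty)$ (with $0\cdot\infty=0$). It is normal if $\omega(\sup_t x_t)=\sup_t\omega(x_t)$ whenever $(x_t)$ is an increasing net in $N_+$ possessing a supremum in $N_+$. For $\nu\ll\mu$, $\psi_\nu(f)=\int_X f\,d\nu$ for $f\in M_+$. *)

theory Defs
  imports "HOL-Analysis.Analysis" "HOL-Algebra.Module" "HOL-Algebra.Order"
begin

section \<open>Increasing nets and suprema\<close>

text \<open>Suprema in a partially ordered set \<open>L\<close> are expressed by the library predicate
  \<^term>\<open>least L s (Upper L A)\<close>.\<close>

definition directed_index :: "'i set \<Rightarrow> ('i \<Rightarrow> 'i \<Rightarrow> bool) \<Rightarrow> bool" where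
  "directed_index I r \<longleftrightarrow> I \<noteq> {} \<and> (\<forall>i\<in>I. r i i) \<and>
     (\<forall>i\<in>I. \<forall>j\<in>I. \<forall>k\<in>I. r i j \<longrightarrow> r j k \<longrightarrow> r i k) \<and>
     (\<forall>i\<in>I. \<forall>j\<in>I. \<exists>k\<in>I. r i k \<and> r j k)"

definition increasing_net ::
    "('e, 'b) gorder_scheme \<Rightarrow> 'i set \<Rightarrow> ('i \<Rightarrow> 'i \<Rightarrow> bool) \<Rightarrow> ('i \<Rightarrow> 'e) \<Rightarrow> bool" where
  "increasing_net L I r x \<longleftrightarrow> directed_index I r \<and> x ` I \<subseteq> carrier L \<and>
     (\<forall>i\<in>I. \<forall>j\<in>I. r i j \<longrightarrow> le L (x i) (x j))"


section \<open>Positivity, projections and weights in complex star-algebras\<close>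

text \<open>The order, the projections and the weights of a C*-algebra depend only on its underlying
  complex star-algebra, so the record carries no norm.\<close>

record 'e star_algebra = "(complex, 'e) module" +
  star :: "'e \<Rightarrow> 'e"

definition pos_cone :: "('e, 'b) star_algebra_scheme \<Rightarrow> 'e set" where
  "pos_cone A = {star A y \<otimes>\<^bsub>A\<^esub> y | y. y \<in> carrier A}"

definition star_le :: "('e, 'b) star_algebra_scheme \<Rightarrow> 'e \<Rightarrow> 'e \<Rightarrow> bool" where
  "star_le A x y \<longleftrightarrow> (\<exists>z\<in>pos_cone A. y = x \<oplus>\<^bsub>A\<^esub> z)"

definition projections :: "('e, 'b) star_algebra_scheme \<Rightarrow> 'e set" where
  "projections A = {p \<in> carrier A. star A p = p \<and> p \<otimes>\<^bsub>A\<^esub> p = p}"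

definition pos_order :: "('e, 'b) star_algebra_scheme \<Rightarrow> 'e gorder" where
  "pos_order A = \<lparr>carrier = pos_cone A, eq = (=), le = star_le A\<rparr>"

definition proj_order :: "('e, 'b) star_algebra_scheme \<Rightarrow> 'e gorder" where
  "proj_order A = \<lparr>carrier = projections A, eq = (=), le = star_le A\<rparr>"

text \<open>A weight is a total function of which only the values on the positive cone matter.
  In \<^typ>\<open>ennreal\<close> the convention \<open>0 \<cdot> \<infinity> = 0\<close> is built in.\<close>

definition weight :: "('e, 'b) star_algebra_scheme \<Rightarrow> ('e \<Rightarrow> ennreal) \<Rightarrow> bool" where
  "weight A \<omega> \<longleftrightarrow>
     (\<forall>x\<in>pos_cone A. \<forall>y\<in>pos_cone A. \<omega> (x \<oplus>\<^bsub>A\<^esub> y) = \<omega> x + \<omega> y) \<and>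
     (\<forall>t\<ge>0. \<forall>x\<in>pos_cone A. \<omega> (complex_of_real t \<odot>\<^bsub>A\<^esub> x) = ennreal t * \<omega> x)"

text \<open>A definition cannot quantify over the type of the index set of a net. Here, and in the
  definition of Dedekind measures below, index sets are taken in the type of the elements. This
  is no restriction, since the range of a net, as a net indexed by itself, has the same
  upper bounds; see \<open>normal_weight_any_net\<close> and \<open>dedekind_any_net\<close> for arbitrary index types.\<close>

definition normal_weight :: "('e, 'b) star_algebra_scheme \<Rightarrow> ('e \<Rightarrow> ennreal) \<Rightarrow> bool" where
  "normal_weight A \<omega> \<longleftrightarrow> weight A \<omega> \<and>
     (\<forall>(I :: 'e set) r x s.
        increasing_net (pos_order A) I r x \<longrightarrow>
        least (pos_order A) s (Upper (pos_order A) (x ` I)) \<longrightarrow>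
        \<omega> s = (SUP i\<in>I. \<omega> (x i)))"


section \<open>The algebra of essentially bounded functions\<close>

definition Linf_funs :: "'a measure \<Rightarrow> ('a \<Rightarrow> complex) set" where
  "Linf_funs M = {f \<in> borel_measurable M. \<exists>C. AE t in M. cmod (f t) \<le> C}"

definition Linf_rel :: "'a measure \<Rightarrow> (('a \<Rightarrow> complex) \<times> ('a \<Rightarrow> complex)) set" where
  "Linf_rel M = {(f, g). f \<in> Linf_funs M \<and> g \<in> Linf_funs M \<and> (AE t in M. f t = g t)}"

definition Linf_class :: "'a measure \<Rightarrow> ('a \<Rightarrow> complex) \<Rightarrow> ('a \<Rightarrow> complex) set" where
  "Linf_class M f = Linf_rel M `` {f}"

definition Linf :: "'a measure \<Rightarrow> ('a \<Rightarrow> complex) set star_algebra" where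
  "Linf M =
     \<lparr>carrier = Linf_funs M // Linf_rel M,
      mult = (\<lambda>a b. \<Union>f\<in>a. \<Union>g\<in>b. Linf_class M (\<lambda>t. f t * g t)),
      one = Linf_class M (\<lambda>t. 1),
      zero = Linf_class M (\<lambda>t. 0),
      add = (\<lambda>a b. \<Union>f\<in>a. \<Union>g\<in>b. Linf_class M (\<lambda>t. f t + g t)),
      smult = (\<lambda>c a. \<Union>f\<in>a. Linf_class M (\<lambda>t. c * f t)),
      star = (\<lambda>a. \<Union>f\<in>a. Linf_class M (\<lambda>t. cnj (f t)))\<rparr>"


section \<open>Properties of measures\<close>

text \<open>The library locale \<^locale>\<open>semifinite_measure\<close> does not require the subset of finite measure
  to be non-null, so it holds for every measure.\<close>

definition semifinite :: "'a measure \<Rightarrow> bool" where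
  "semifinite M \<longleftrightarrow> (\<forall>E\<in>sets M. emeasure M E = \<infinity> \<longrightarrow>
     (\<exists>F\<in>sets M. F \<subseteq> E \<and> 0 < emeasure M F \<and> emeasure M F < \<infinity>))"

definition dedekind :: "'a measure \<Rightarrow> bool" where
  "dedekind M \<longleftrightarrow>
     (\<forall>(I :: ('a \<Rightarrow> complex) set set) r p.
        increasing_net (proj_order (Linf M)) I r p \<longrightarrow>
        (\<exists>s. least (proj_order (Linf M)) s (Upper (proj_order (Linf M)) (p ` I))))"

definition localizable :: "'a measure \<Rightarrow> bool" where
  "localizable M \<longleftrightarrow> semifinite M \<and> dedekind M"

text \<open>In the following, \<open>N\<close> is a second measure on the \<open>\<sigma>\<close>-algebra of \<open>M\<close>.\<close>

definition has_support :: "'a measure \<Rightarrow> 'a measure \<Rightarrow> bool" where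
  "has_support M N \<longleftrightarrow> (\<exists>E0\<in>sets M.
     (\<forall>E\<in>sets M. emeasure N E = emeasure N (E \<inter> E0)) \<and>
     (\<forall>E\<in>sets M. E \<subseteq> E0 \<longrightarrow> emeasure M E > 0 \<longrightarrow> emeasure N E > 0))"

definition rel_semifinite :: "'a measure \<Rightarrow> 'a measure \<Rightarrow> bool" where
  "rel_semifinite M N \<longleftrightarrow> (\<forall>E\<in>sets M. emeasure N E > 0 \<longrightarrow>
     (\<exists>F\<in>sets M. F \<subseteq> E \<and> emeasure M F < \<infinity> \<and> emeasure N F > 0))"

definition has_density :: "'a measure \<Rightarrow> 'a measure \<Rightarrow> ('a \<Rightarrow> ennreal) \<Rightarrow> bool" where
  "has_density M N h \<longleftrightarrow> h \<in> borel_measurable M \<and>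
     (\<forall>E\<in>sets M. emeasure N E = (\<integral>\<^sup>+t\<in>E. h t \<partial>M))"

text \<open>Integration of a class \<open>a\<close> in the positive cone of \<^term>\<open>Linf M\<close>. A representative is almost
  everywhere real and nonnegative, and its choice is immaterial when \<open>N\<close> is absolutely continuous
  with respect to \<open>M\<close>; see \<open>int_weight_class\<close>.\<close>

definition int_weight :: "'a measure \<Rightarrow> ('a \<Rightarrow> complex) set \<Rightarrow> ennreal" where
  "int_weight N a = (\<integral>\<^sup>+t. ennreal (Re ((SOME f. f \<in> a) t)) \<partial>N)"


section \<open>Consistency of the definitions\<close>

lemma equiv_Linf_rel: "equiv (Linf_funs M) (Linf_rel M)"
proof (rule equivI)
  show "refl_on (Linf_funs M) (Linf_rel M)"
    by (auto simp: refl_on_def Linf_rel_def)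
  show "sym (Linf_rel M)"
    by (auto simp: sym_def Linf_rel_def eq_commute)
  show "trans (Linf_rel M)"
    unfolding trans_def Linf_rel_def by (auto elim: AE_mp)
qed (auto simp: Linf_rel_def)

lemma Linf_class_eq_iff:
  assumes "f \<in> Linf_funs M" "g \<in> Linf_funs M"
  shows "Linf_class M f = Linf_class M g \<longleftrightarrow> (AE t in M. f t = g t)"
  unfolding Linf_class_def using eq_equiv_class_iff[OF equiv_Linf_rel assms] assms
  by (auto simp: Linf_rel_def)

lemma mem_Linf_class:
  assumes "f \<in> Linf_funs M"
  shows "g \<in> Linf_class M f \<longleftrightarrow> g \<in> Linf_funs M \<and> (AE t in M. f t = g t)"
  using assms by (auto simp: Linf_class_def Linf_rel_def)

lemma carrier_Linf: "carrier (Linf M) = Linf_class M ` Linf_funs M"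
  by (auto simp: Linf_def quotient_def Linf_class_def)

lemma carrier_Linf_rep: "a \<in> carrier (Linf M) \<Longrightarrow> \<exists>f\<in>Linf_funs M. a = Linf_class M f"
  by (auto simp: carrier_Linf)

lemma Linf_funs_add:
  assumes "f \<in> Linf_funs M" "g \<in> Linf_funs M"
  shows "(\<lambda>t. f t + g t) \<in> Linf_funs M"
proof -
  from assms obtain C D where "AE t in M. cmod (f t) \<le> C" "AE t in M. cmod (g t) \<le> D"
    by (auto simp: Linf_funs_def)
  then have "AE t in M. cmod (f t + g t) \<le> C + D"
    by eventually_elim (meson add_mono norm_triangle_le)
  then show ?thesis using assms by (auto simp: Linf_funs_def)
qed

lemma Linf_funs_mult:
  assumes "f \<in> Linf_funs M" "g \<in> Linf_funs M"
  shows "(\<lambda>t. f t * g t) \<in> Linf_funs M"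
proof -
  from assms obtain C D where "AE t in M. cmod (f t) \<le> C" "AE t in M. cmod (g t) \<le> D"
    by (auto simp: Linf_funs_def)
  then have "AE t in M. cmod (f t * g t) \<le> \<bar>C\<bar> * \<bar>D\<bar>"
    by eventually_elim (auto simp: norm_mult intro!: mult_mono)
  then show ?thesis using assms by (auto simp: Linf_funs_def)
qed

lemma Linf_funs_bounded:
  assumes "f \<in> borel_measurable M" "\<And>t. cmod (f t) \<le> C"
  shows "f \<in> Linf_funs M"
  using assms by (auto simp: Linf_funs_def)

lemma Linf_funs_const: "(\<lambda>t. c) \<in> Linf_funs M"
  by (rule Linf_funs_bounded) auto

lemma Linf_funs_cnj:
  assumes "f \<in> Linf_funs M"
  shows "(\<lambda>t. cnj (f t)) \<in> Linf_funs M"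
proof -
  have "cnj \<in> borel_measurable borel"
    by (intro borel_measurable_continuous_onI continuous_intros)
  then show ?thesis
    using assms by (auto simp: Linf_funs_def)
qed

lemma Linf_funs_indicator: "E \<in> sets M \<Longrightarrow> indicator E \<in> Linf_funs M"
  by (rule Linf_funs_bounded[where C = 1]) (auto simp: indicator_def)

lemma UN_Linf_class1:
  assumes "f \<in> Linf_funs M"
    and "\<And>f'. f' \<in> Linf_funs M \<Longrightarrow> AE t in M. f t = f' t \<Longrightarrow> S f' = T"
  shows "(\<Union>f'\<in>Linf_class M f. S f') = T"
proof -
  have "f \<in> Linf_class M f" using assms(1) by (simp add: mem_Linf_class)
  moreover have "S f' = T" if "f' \<in> Linf_class M f" for f'
    using that assms by (simp add: mem_Linf_class)
  ultimately show ?thesis by blast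
qed

lemma Linf_add_class:
  assumes f: "f \<in> Linf_funs M" and g: "g \<in> Linf_funs M"
  shows "Linf_class M f \<oplus>\<^bsub>Linf M\<^esub> Linf_class M g = Linf_class M (\<lambda>t. f t + g t)"
proof -
  have "Linf_class M (\<lambda>t. f' t + g' t) = Linf_class M (\<lambda>t. f t + g t)"
    if "f' \<in> Linf_funs M" "AE t in M. f t = f' t" "g' \<in> Linf_funs M" "AE t in M. g t = g' t"
    for f' g'
  proof -
    have "AE t in M. f' t + g' t = f t + g t"
      using that(2,4) by eventually_elim simp
    then show ?thesis
      by (subst Linf_class_eq_iff) (intro Linf_funs_add f g that)+
  qed
  then have "(\<Union>f'\<in>Linf_class M f. \<Union>g'\<in>Linf_class M g. Linf_class M (\<lambda>t. f' t + g' t))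
      = Linf_class M (\<lambda>t. f t + g t)"
    by (intro UN_Linf_class1 f g)
  then show ?thesis
    by (simp add: Linf_def)
qed

lemma Linf_mult_class:
  assumes f: "f \<in> Linf_funs M" and g: "g \<in> Linf_funs M"
  shows "Linf_class M f \<otimes>\<^bsub>Linf M\<^esub> Linf_class M g = Linf_class M (\<lambda>t. f t * g t)"
proof -
  have "Linf_class M (\<lambda>t. f' t * g' t) = Linf_class M (\<lambda>t. f t * g t)"
    if "f' \<in> Linf_funs M" "AE t in M. f t = f' t" "g' \<in> Linf_funs M" "AE t in M. g t = g' t"
    for f' g'
  proof -
    have "AE t in M. f' t * g' t = f t * g t"
      using that(2,4) by eventually_elim simp
    then show ?thesis
      by (subst Linf_class_eq_iff) (intro Linf_funs_mult f g that)+
  qed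
  then have "(\<Union>f'\<in>Linf_class M f. \<Union>g'\<in>Linf_class M g. Linf_class M (\<lambda>t. f' t * g' t))
      = Linf_class M (\<lambda>t. f t * g t)"
    by (intro UN_Linf_class1 f g)
  then show ?thesis
    by (simp add: Linf_def)
qed

lemma Linf_smult_class:
  assumes f: "f \<in> Linf_funs M"
  shows "c \<odot>\<^bsub>Linf M\<^esub> Linf_class M f = Linf_class M (\<lambda>t. c * f t)"
proof -
  have "Linf_class M (\<lambda>t. c * f' t) = Linf_class M (\<lambda>t. c * f t)"
    if "f' \<in> Linf_funs M" "AE t in M. f t = f' t" for f'
  proof -
    have "AE t in M. c * f' t = c * f t"
      using that(2) by eventually_elim simp
    then show ?thesis
      by (subst Linf_class_eq_iff) (intro Linf_funs_mult Linf_funs_const f that)+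
  qed
  then have "(\<Union>f'\<in>Linf_class M f. Linf_class M (\<lambda>t. c * f' t)) = Linf_class M (\<lambda>t. c * f t)"
    by (intro UN_Linf_class1 f)
  then show ?thesis
    by (simp add: Linf_def)
qed

lemma Linf_star_class:
  assumes f: "f \<in> Linf_funs M"
  shows "star (Linf M) (Linf_class M f) = Linf_class M (\<lambda>t. cnj (f t))"
proof -
  have "Linf_class M (\<lambda>t. cnj (f' t)) = Linf_class M (\<lambda>t. cnj (f t))"
    if "f' \<in> Linf_funs M" "AE t in M. f t = f' t" for f'
  proof -
    have "AE t in M. cnj (f' t) = cnj (f t)"
      using that(2) by eventually_elim simp
    then show ?thesis
      by (subst Linf_class_eq_iff) (intro Linf_funs_cnj f that)+
  qed
  then have "(\<Union>f'\<in>Linf_class M f. Linf_class M (\<lambda>t. cnj (f' t))) = Linf_class M (\<lambda>t. cnj (f t))"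
    by (intro UN_Linf_class1 f)
  then show ?thesis
    by (simp add: Linf_def)
qed

lemma pos_cone_Linf_iff:
  assumes f: "f \<in> Linf_funs M"
  shows "Linf_class M f \<in> pos_cone (Linf M) \<longleftrightarrow> (AE t in M. Im (f t) = 0 \<and> 0 \<le> Re (f t))"
proof
  assume "Linf_class M f \<in> pos_cone (Linf M)"
  then obtain g where g: "g \<in> Linf_funs M" "Linf_class M f = Linf_class M (\<lambda>t. cnj (g t) * g t)"
    by (auto simp: pos_cone_def carrier_Linf Linf_star_class Linf_mult_class Linf_funs_cnj)
  then have "AE t in M. f t = cnj (g t) * g t"
    using f by (simp add: Linf_class_eq_iff Linf_funs_cnj Linf_funs_mult)
  then show "AE t in M. Im (f t) = 0 \<and> 0 \<le> Re (f t)"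
    by eventually_elim auto
next
  assume *: "AE t in M. Im (f t) = 0 \<and> 0 \<le> Re (f t)"
  define g where "g t = complex_of_real (sqrt (Re (f t)))" for t
  from f obtain C where C: "AE t in M. cmod (f t) \<le> C" and [measurable]: "f \<in> borel_measurable M"
    by (auto simp: Linf_funs_def)
  have "AE t in M. cmod (g t) \<le> sqrt C"
    using C * unfolding g_def
    by eventually_elim (auto simp: real_sqrt_le_iff intro: order.trans[OF complex_Re_le_cmod])
  moreover have "g \<in> borel_measurable M"
    unfolding g_def by measurable
  ultimately have g: "g \<in> Linf_funs M"
    by (auto simp: Linf_funs_def)
  have "AE t in M. f t = cnj (g t) * g t"
    using * unfolding g_def by eventually_elim (auto simp: complex_eq_iff)
  then have "Linf_class M f = star (Linf M) (Linf_class M g) \<otimes>\<^bsub>Linf M\<^esub> Linf_class M g"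
    using f g by (simp add: Linf_star_class Linf_mult_class Linf_class_eq_iff Linf_funs_cnj
        Linf_funs_mult)
  then show "Linf_class M f \<in> pos_cone (Linf M)"
    using g by (auto simp: pos_cone_def carrier_Linf)
qed

lemma pos_cone_Linf_subset: "pos_cone (Linf M) \<subseteq> carrier (Linf M)"
  by (auto simp: pos_cone_def carrier_Linf Linf_star_class Linf_mult_class Linf_funs_cnj
      Linf_funs_mult)

lemma star_le_Linf_iff:
  assumes f: "f \<in> Linf_funs M" and g: "g \<in> Linf_funs M"
  shows "star_le (Linf M) (Linf_class M f) (Linf_class M g) \<longleftrightarrow>
    (AE t in M. Im (f t) = Im (g t) \<and> Re (f t) \<le> Re (g t))"
proof
  assume "star_le (Linf M) (Linf_class M f) (Linf_class M g)"
  then obtain z where z: "z \<in> pos_cone (Linf M)"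
      "Linf_class M g = Linf_class M f \<oplus>\<^bsub>Linf M\<^esub> z"
    by (auto simp: star_le_def)
  then obtain d where d: "d \<in> Linf_funs M" "z = Linf_class M d"
    using carrier_Linf_rep[OF subsetD[OF pos_cone_Linf_subset z(1)]] by blast
  have "AE t in M. g t = f t + d t"
    using z d f g by (simp add: Linf_add_class Linf_class_eq_iff Linf_funs_add)
  moreover have "AE t in M. Im (d t) = 0 \<and> 0 \<le> Re (d t)"
    using z d by (simp add: pos_cone_Linf_iff)
  ultimately show "AE t in M. Im (f t) = Im (g t) \<and> Re (f t) \<le> Re (g t)"
    by eventually_elim auto
next
  assume *: "AE t in M. Im (f t) = Im (g t) \<and> Re (f t) \<le> Re (g t)"
  define d where "d t = g t + (-1) * f t" for t
  have d: "d \<in> Linf_funs M"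
    unfolding d_def by (intro Linf_funs_add Linf_funs_mult Linf_funs_const f g)
  have "AE t in M. Im (d t) = 0 \<and> 0 \<le> Re (d t)"
    using * by eventually_elim (auto simp: d_def)
  then have "Linf_class M d \<in> pos_cone (Linf M)"
    using d by (simp add: pos_cone_Linf_iff)
  moreover have "Linf_class M g = Linf_class M f \<oplus>\<^bsub>Linf M\<^esub> Linf_class M d"
    using f g d by (simp add: Linf_add_class d_def)
  ultimately show "star_le (Linf M) (Linf_class M f) (Linf_class M g)"
    by (auto simp: star_le_def)
qed

lemma projections_Linf: "projections (Linf M) = {Linf_class M (indicator E) | E. E \<in> sets M}"
proof safe
  fix p assume p: "p \<in> projections (Linf M)"
  then obtain f where f: "f \<in> Linf_funs M" "p = Linf_class M f"
    by (auto simp: projections_def carrier_Linf)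
  then have [measurable]: "f \<in> borel_measurable M"
    by (auto simp: Linf_funs_def)
  have "AE t in M. f t * f t = f t"
    using p f by (auto simp: projections_def Linf_mult_class Linf_class_eq_iff Linf_funs_mult)
  then have "AE t in M. f t = indicator {t \<in> space M. f t = 1} t"
    using AE_space by eventually_elim (auto simp: indicator_def)
  moreover have E: "{t \<in> space M. f t = 1} \<in> sets M"
    by measurable
  ultimately have "p = Linf_class M (indicator {t \<in> space M. f t = 1})"
    using f by (simp add: Linf_class_eq_iff Linf_funs_indicator)
  with E show "\<exists>E. p = Linf_class M (indicator E) \<and> E \<in> sets M"
    by blast
next
  fix E assume E: "E \<in> sets M"
  have "(\<lambda>t. indicator E t * indicator E t) = (indicator E :: 'a \<Rightarrow> complex)"
    "(\<lambda>t. cnj (indicator E t)) = indicator E"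
    by (auto simp: indicator_def)
  then show "Linf_class M (indicator E) \<in> projections (Linf M)"
    using E by (auto simp: projections_def Linf_funs_indicator Linf_star_class Linf_mult_class
        carrier_Linf)
qed

lemma projections_Linf_subset: "projections (Linf M) \<subseteq> pos_cone (Linf M)"
  by (auto simp: projections_Linf pos_cone_Linf_iff Linf_funs_indicator indicator_def)

lemma partial_order_Linf:
  assumes "carrier L \<subseteq> carrier (Linf M)" "eq L = (=)" "le L = star_le (Linf M)"
  shows "partial_order L"
proof
  fix x y z assume xyz: "x \<in> carrier L" "y \<in> carrier L" "z \<in> carrier L"
    and le: "le L x y" "le L y z"
  from xyz obtain f g h where fgh: "f \<in> Linf_funs M" "g \<in> Linf_funs M" "h \<in> Linf_funs M"
      "x = Linf_class M f" "y = Linf_class M g" "z = Linf_class M h"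
    using carrier_Linf_rep[OF subsetD[OF assms(1) xyz(1)]]
      carrier_Linf_rep[OF subsetD[OF assms(1) xyz(2)]]
      carrier_Linf_rep[OF subsetD[OF assms(1) xyz(3)]] by blast
  have "AE t in M. Im (f t) = Im (g t) \<and> Re (f t) \<le> Re (g t)"
    "AE t in M. Im (g t) = Im (h t) \<and> Re (g t) \<le> Re (h t)"
    using le fgh by (simp_all add: assms star_le_Linf_iff)
  then have "AE t in M. Im (f t) = Im (h t) \<and> Re (f t) \<le> Re (h t)"
    by eventually_elim auto
  then show "le L x z"
    using fgh by (simp add: assms star_le_Linf_iff)
next
  fix x y assume xy: "x \<in> carrier L" "y \<in> carrier L" and le: "le L x y" "le L y x"
  from xy obtain f g where fg: "f \<in> Linf_funs M" "g \<in> Linf_funs M"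
      "x = Linf_class M f" "y = Linf_class M g"
    using carrier_Linf_rep[OF subsetD[OF assms(1) xy(1)]]
      carrier_Linf_rep[OF subsetD[OF assms(1) xy(2)]] by blast
  have "AE t in M. Im (f t) = Im (g t) \<and> Re (f t) \<le> Re (g t)"
    "AE t in M. Im (g t) = Im (f t) \<and> Re (g t) \<le> Re (f t)"
    using le fg by (simp_all add: assms star_le_Linf_iff)
  then have "AE t in M. f t = g t"
    by eventually_elim (auto simp: complex_eq_iff)
  then show "eq L x y"
    using fg by (simp add: assms Linf_class_eq_iff)
next
  fix x assume x: "x \<in> carrier L"
  obtain f where f: "f \<in> Linf_funs M" "x = Linf_class M f"
    using carrier_Linf_rep[OF subsetD[OF assms(1) x]] by blast
  then show "le L x x"
    by (simp add: assms star_le_Linf_iff)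
qed (simp_all add: assms(2,3))

lemma partial_order_pos_order_Linf: "partial_order (pos_order (Linf M))"
  by (rule partial_order_Linf[of _ M]) (auto simp: pos_order_def dest: subsetD[OF pos_cone_Linf_subset])

lemma partial_order_proj_order_Linf: "partial_order (proj_order (Linf M))"
  by (rule partial_order_Linf[of _ M])
    (auto simp: proj_order_def projections_def)

lemma increasing_net_range:
  assumes "partial_order L" "increasing_net L I r x"
  shows "increasing_net L (x ` I) (le L) id"
proof -
  have sub: "x ` I \<subseteq> carrier L" and dirI: "directed_index I r"
    and mono: "\<forall>i\<in>I. \<forall>j\<in>I. r i j \<longrightarrow> le L (x i) (x j)"
    using assms(2) unfolding increasing_net_def by blast+
  have ne: "I \<noteq> {}" and dir: "\<forall>i\<in>I. \<forall>j\<in>I. \<exists>k\<in>I. r i k \<and> r j k"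
    using dirI unfolding directed_index_def by blast+
  have weak: "weak_partial_order L"
    using assms(1) by (rule partial_order.axioms(1))
  have "directed_index (x ` I) (le L)"
    unfolding directed_index_def
  proof (intro conjI ballI impI)
    show "x ` I \<noteq> {}"
      using ne by simp
    show "le L u u" if "u \<in> x ` I" for u
      using weak_partial_order.le_refl[OF weak] that sub by blast
    show "le L u w" if "u \<in> x ` I" "v \<in> x ` I" "w \<in> x ` I" "le L u v" "le L v w" for u v w
      by (rule weak_partial_order.le_trans[OF weak that(4,5)]) (use that sub in blast)+
    fix u v assume "u \<in> x ` I" "v \<in> x ` I"
    then obtain i j where ij: "i \<in> I" "j \<in> I" "u = x i" "v = x j"
      by blast
    then obtain k where "k \<in> I" "r i k" "r j k"
      using dir by blast
    then show "\<exists>w\<in>x ` I. le L u w \<and> le L v w"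
      using ij mono by blast
  qed
  then show ?thesis
    using sub unfolding increasing_net_def by simp
qed

lemma normal_weight_any_net:
  assumes "partial_order (pos_order A)" "normal_weight A \<omega>"
    and "increasing_net (pos_order A) I r x"
    and "least (pos_order A) s (Upper (pos_order A) (x ` I))"
  shows "\<omega> s = (SUP i\<in>I. \<omega> (x i))"
proof -
  have "increasing_net (pos_order A) (x ` I) (le (pos_order A)) id"
    by (rule increasing_net_range[OF assms(1,3)])
  moreover have "least (pos_order A) s (Upper (pos_order A) (id ` (x ` I)))"
    using assms(4) by simp
  ultimately have "\<omega> s = (SUP u\<in>x ` I. \<omega> (id u))"
    using assms(2) unfolding normal_weight_def by blast
  then show ?thesis
    by (simp add: image_image)
qed

lemma dedekind_any_net:
  assumes "dedekind M" "increasing_net (proj_order (Linf M)) I r p"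
  shows "\<exists>s. least (proj_order (Linf M)) s (Upper (proj_order (Linf M)) (p ` I))"
proof -
  have "increasing_net (proj_order (Linf M)) (p ` I) (le (proj_order (Linf M))) id"
    by (rule increasing_net_range[OF partial_order_proj_order_Linf assms(2)])
  then have "\<exists>s. least (proj_order (Linf M)) s (Upper (proj_order (Linf M)) (id ` (p ` I)))"
    using assms(1) unfolding dedekind_def by blast
  then show ?thesis
    by simp
qed

lemma int_weight_class:
  assumes f: "f \<in> Linf_funs M" and N: "sets N = sets M" "absolutely_continuous M N"
  shows "int_weight N (Linf_class M f) = (\<integral>\<^sup>+t. ennreal (Re (f t)) \<partial>N)"
proof -
  define g where "g = (SOME f'. f' \<in> Linf_class M f)"
  have "f \<in> Linf_class M f"
    using f by (simp add: mem_Linf_class)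
  then have "g \<in> Linf_class M f"
    unfolding g_def by (rule someI[where P = "\<lambda>f'. f' \<in> Linf_class M f"])
  then have "AE t in M. f t = g t"
    using f by (simp add: mem_Linf_class)
  then have "AE t in N. f t = g t"
    using absolutely_continuous_AE[OF N] by blast
  then have "(\<integral>\<^sup>+t. ennreal (Re (g t)) \<partial>N) = (\<integral>\<^sup>+t. ennreal (Re (f t)) \<partial>N)"
    by (intro nn_integral_cong_AE) auto
  then show ?thesis
    by (simp add: int_weight_def g_def)
qed

end

theory Submission
  imports Defs
begin

text \<open>On a set \<open>F\<close> of finite \<open>\<mu>\<close>-measure the Radon--Nikodym theorem needs no finiteness of \<open>\<nu>\<close> and
  gives a density \<open>g F\<close>. Dedekind completeness glues these to one function, and a \<open>\<mu>\<close>-semifinite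
  \<open>\<nu>\<close> is determined by its values on sets of finite \<open>\<mu>\<close>-measure. Measures with a density are
  themselves \<open>\<mu>\<close>-semifinite, so the normality of their weights can be tested on sets of finite
  measure, where suprema of nets are attained along sequences. Conversely, a normal weight is
  integration against the measure \<open>E \<mapsto> \<omega> [\<chi>\<^sub>E]\<close>, and applying normality to the net of all
  \<open>[\<chi>\<^sub>F]\<close> with \<open>F \<subseteq> E\<close> of finite measure shows that this measure is \<open>\<mu>\<close>-semifinite.\<close>

section \<open>Densities and semifiniteness\<close>

text \<open>Neither measure need be \<sigma>-finite. The obstacle is that the sets of finite measure
  form an uncountable directed family: two local densities agree on the common part of their domains
  outside a null set that depends on the pair, and uncountably many such null sets cannot be
  discarded together. Superlevel sets turn the gluing problem into one about projections, where a
  supremum absorbs these null sets, and restricting to rational levels leaves only countably many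
  conditions on each fixed set. The same obstacle returns for normality: the supremum of an
  uncountable net in the algebra need not be a pointwise supremum, so monotone convergence does not
  apply to it directly. The passage from local to global rests on one device: an exceptional set
  that is not null contains a set of finite positive measure, on which the finite theory gives a
  contradiction.\<close>

lemma absolutely_continuous_emeasure_0:
  assumes "absolutely_continuous M N" "E \<in> sets M" "emeasure M E = 0"
  shows "emeasure N E = 0"
proof -
  have "E \<in> null_sets M" using assms(2,3) by (rule null_setsI[rotated])
  then show ?thesis using assms(1) unfolding absolutely_continuous_def by auto
qed

lemma semifinite_obtain:
  assumes "semifinite M" "E \<in> sets M" "emeasure M E \<noteq> 0"
  obtains F where "F \<in> sets M" "F \<subseteq> E" "0 < emeasure M F" "emeasure M F < \<infinity>"
proof (cases "emeasure M E = \<infinity>")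
  case True
  then show ?thesis using assms that unfolding semifinite_def by blast
next
  case False
  then show ?thesis using assms that[of E] by (auto simp: less_top zero_less_iff_neq_zero)
qed

lemma finite_measure_density_indicator:
  assumes "F \<in> sets M" "emeasure M F < \<infinity>"
  shows "finite_measure (density M (indicator F))"
proof
  show "emeasure (density M (indicator F)) (space (density M (indicator F))) \<noteq> \<infinity>"
    using assms by (simp add: emeasure_restricted)
qed

text \<open>Restricted to \<open>F\<close> the base measure is finite, and over a finite base a
  density is determined almost everywhere even where it is infinite.\<close>

lemma density_unique_on:
  fixes g g' :: "'a \<Rightarrow> ennreal"
  assumes F: "F \<in> sets M" "emeasure M F < \<infinity>"
    and [measurable]: "g \<in> borel_measurable M" "g' \<in> borel_measurable M"
    and eq: "\<And>E. E \<in> sets M \<Longrightarrow> E \<subseteq> F \<Longrightarrow> (\<integral>\<^sup>+t\<in>E. g t \<partial>M) = (\<integral>\<^sup>+t\<in>E. g' t \<partial>M)"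
  shows "AE t in M. t \<in> F \<longrightarrow> g t = g' t"
proof -
  have [measurable]: "F \<in> sets M" by fact
  interpret finite_measure "density M (indicator F)"
    by (rule finite_measure_density_indicator[OF F])
  have "AE t in density M (indicator F). g t = g' t"
  proof (rule density_unique)
    show "density (density M (indicator F)) g = density (density M (indicator F)) g'"
    proof (rule measure_eqI)
      fix E assume "E \<in> sets (density (density M (indicator F)) g)"
      then have [measurable]: "E \<in> sets M" by simp
      have *: "emeasure (density (density M (indicator F)) k) E = (\<integral>\<^sup>+t\<in>(F \<inter> E). k t \<partial>M)"
        if [measurable]: "k \<in> borel_measurable M" for k :: "'a \<Rightarrow> ennreal"
        by (simp add: density_density_eq emeasure_density)
          (intro nn_integral_cong, auto simp: indicator_def)
      show "emeasure (density (density M (indicator F)) g) E =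
          emeasure (density (density M (indicator F)) g') E"
        by (subst (1 2) *) (auto intro!: eq)
    qed simp
  qed simp_all
  then show ?thesis
    by (subst (asm) AE_density) (auto elim!: AE_mp simp: indicator_def)
qed

lemma has_density_iff:
  assumes "sets N = sets M"
  shows "has_density M N h \<longleftrightarrow> h \<in> borel_measurable M \<and> density M h = N"
proof safe
  assume h: "has_density M N h"
  then show [measurable]: "h \<in> borel_measurable M" by (simp add: has_density_def)
  show "density M h = N"
    using h assms by (intro measure_eqI) (auto simp: has_density_def emeasure_density)
qed (auto simp: has_density_def emeasure_density)

text \<open>If the set where \<open>h\<close> and \<open>h'\<close> differ were not null, it would
  contain a set of finite positive measure, contradicting uniqueness on that set.\<close>

lemma has_density_unique:
  assumes sf: "semifinite M" and h: "has_density M N h" "has_density M N h'"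
  shows "AE t in M. h t = h' t"
proof -
  have [measurable]: "h \<in> borel_measurable M" "h' \<in> borel_measurable M"
    using h by (auto simp: has_density_def)
  define D where "D = {t \<in> space M. h t \<noteq> h' t}"
  have D: "D \<in> sets M" unfolding D_def by measurable
  have "emeasure M D = 0"
  proof (rule ccontr)
    assume "emeasure M D \<noteq> 0"
    from semifinite_obtain[OF sf D this] obtain F where
      F: "F \<in> sets M" "F \<subseteq> D" "0 < emeasure M F" "emeasure M F < \<infinity>" .
    have "AE t in M. t \<in> F \<longrightarrow> h t = h' t"
      using h by (intro density_unique_on F(1,4)) (auto simp: has_density_def)
    then have "AE t in M. t \<notin> F"
      using F(2) by (auto simp: D_def elim!: AE_mp)
    then have "F \<in> null_sets M"
      using F(1) by (simp add: AE_iff_null_sets)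
    then show False using F(3) by auto
  qed
  then show ?thesis
    using D by (intro AE_I[of _ _ D]) (auto simp: D_def)
qed

lemma has_density_imp_absolutely_continuous:
  assumes "has_density M N h" "sets N = sets M"
  shows "absolutely_continuous M N"
proof -
  have "density M h = N" "h \<in> borel_measurable M"
    using assms by (auto simp: has_density_iff)
  then show ?thesis using absolutely_continuousI_density by blast
qed

text \<open>The set where the density is positive serves as support: the integral over its
  complement vanishes, and a function positive on a non-null set has positive integral
  there.\<close>

lemma has_density_imp_has_support:
  assumes h: "has_density M N h" and N: "sets N = sets M"
  shows "has_support M N"
proof -
  have [measurable]: "h \<in> borel_measurable M"
    using h by (auto simp: has_density_def)
  define S where "S = {t \<in> space M. 0 < h t}"
  have S[measurable]: "S \<in> sets M" unfolding S_def by measurable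
  have "emeasure N E = emeasure N (E \<inter> S)" if E: "E \<in> sets M" for E
  proof -
    have [measurable]: "E \<in> sets M" by fact
    have "(\<integral>\<^sup>+t\<in>E. h t \<partial>M) = (\<integral>\<^sup>+t\<in>(E \<inter> S). h t \<partial>M)"
      by (intro nn_integral_cong) (auto simp: S_def indicator_def)
    then show ?thesis using h E S by (simp add: has_density_def)
  qed
  moreover have "0 < emeasure N E" if E: "E \<in> sets M" "E \<subseteq> S" "0 < emeasure M E" for E
  proof (rule ccontr)
    have [measurable]: "E \<in> sets M" by fact
    assume "\<not> 0 < emeasure N E"
    then have "(\<integral>\<^sup>+t\<in>E. h t \<partial>M) = 0" using h E by (simp add: has_density_def)
    then have "AE t in M. h t * indicator E t = 0"
      by (subst (asm) nn_integral_0_iff_AE) auto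
    then have "AE t in M. t \<notin> E"
      by eventually_elim (use E(2) in \<open>auto simp: S_def indicator_def\<close>)
    then have "E \<in> null_sets M" using E(1) by (simp add: AE_iff_null_sets)
    then show False using E(3) by auto
  qed
  ultimately show ?thesis using S unfolding has_support_def by blast
qed

text \<open>A set charged by \<open>N\<close> meets the support in a set that is non-null for
  \<open>M\<close>. A subset of it of finite positive measure still lies in the support, hence is
  charged by \<open>N\<close>.\<close>

lemma has_support_imp_rel_semifinite:
  assumes sf: "semifinite M" and ac: "absolutely_continuous M N" and "has_support M N"
  shows "rel_semifinite M N"
  unfolding rel_semifinite_def
proof (intro ballI impI)
  from assms(3) obtain S where S: "S \<in> sets M"
    "\<And>E. E \<in> sets M \<Longrightarrow> emeasure N E = emeasure N (E \<inter> S)"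
    "\<And>E. E \<in> sets M \<Longrightarrow> E \<subseteq> S \<Longrightarrow> 0 < emeasure M E \<Longrightarrow> 0 < emeasure N E"
    unfolding has_support_def by blast
  fix E assume E: "E \<in> sets M" "0 < emeasure N E"
  have ES: "E \<inter> S \<in> sets M" by (rule sets.Int[OF E(1) S(1)])
  have "emeasure M (E \<inter> S) \<noteq> 0"
    using absolutely_continuous_emeasure_0[OF ac ES] E S(2)[OF E(1)] by auto
  from semifinite_obtain[OF sf ES this] obtain F where
    "F \<in> sets M" "F \<subseteq> E \<inter> S" "0 < emeasure M F" "emeasure M F < \<infinity>" .
  then show "\<exists>F\<in>sets M. F \<subseteq> E \<and> emeasure M F < \<infinity> \<and> 0 < emeasure N F"
    using S(3) by blast
qed

text \<open>Makes the exhaustion formula below available for measures given by a density, both to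
  compare such a measure with \<open>N\<close> and to test integrals on sets of finite
  measure.\<close>

lemma rel_semifinite_density:
  assumes "semifinite M" "h \<in> borel_measurable M"
  shows "rel_semifinite M (density M h)"
proof -
  have h: "has_density M (density M h) h" using assms by (simp add: has_density_iff)
  show ?thesis
    by (rule has_support_imp_rel_semifinite[OF assms(1)
          has_density_imp_absolutely_continuous[OF h] has_density_imp_has_support[OF h]]) simp_all
qed

section \<open>Exhaustion by sets of finite measure, and countable chains in directed
  families\<close>

lemma directed_finite_measure_subsets:
  "directed_index {F \<in> sets M. F \<subseteq> E \<and> emeasure M F < \<infinity>} (\<subseteq>)" (is "directed_index ?I _")
  unfolding directed_index_def
proof (intro conjI ballI impI)
  show "?I \<noteq> {}" by (auto intro!: exI[of _ "{}"])
  fix F F' assume F: "F \<in> ?I" "F' \<in> ?I"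
  have "emeasure M (F \<union> F') \<le> emeasure M F + emeasure M F'"
    using F by (intro emeasure_subadditive) auto
  also have "\<dots> < \<infinity>" using F by auto
  finally have "F \<union> F' \<in> ?I" using F by auto
  then show "\<exists>K\<in>?I. F \<subseteq> K \<and> F' \<subseteq> K" by blast
qed auto

text \<open>Take finite-measure sets nearly attaining the supremum \<open>s\<close> and form their
  increasing unions \<open>D n\<close>. If \<open>E\<close> had mass beyond \<open>s\<close>,
  relative semifiniteness would give a charged finite-measure set \<open>G\<close> outside all
  \<open>D n\<close>, and adding it would exceed \<open>s\<close>.\<close>

lemma rel_semifinite_emeasure_SUP:
  assumes rs: "rel_semifinite M N" and N: "sets N = sets M" and E: "E \<in> sets M"
  shows "emeasure N E = (SUP F\<in>{F \<in> sets M. F \<subseteq> E \<and> emeasure M F < \<infinity>}. emeasure N F)"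
    (is "_ = (SUP F\<in>?A. _)")
proof (rule antisym)
  show "(SUP F\<in>?A. emeasure N F) \<le> emeasure N E"
    using E N by (intro SUP_least emeasure_mono) auto
  define s where "s = (SUP F\<in>?A. emeasure N F)"
  have ub: "emeasure N F \<le> s" if "F \<in> ?A" for F
    unfolding s_def using that by (rule SUP_upper)
  have "?A \<noteq> {}" by (auto intro!: exI[of _ "{}"])
  from ennreal_SUP_countable_SUP[OF this, of "emeasure N"] obtain f where
    f: "range f \<subseteq> emeasure N ` ?A" "s = (SUP n::nat. f n)"
    unfolding s_def by blast
  then have "\<forall>n. \<exists>F. F \<in> ?A \<and> f n = emeasure N F" by blast
  then obtain F where "\<forall>n. F n \<in> ?A \<and> f n = emeasure N (F n)" by (rule choice[THEN exE])
  then have F: "\<And>n. F n \<in> ?A" "\<And>n. f n = emeasure N (F n)" by blast+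
  define D where "D n = (\<Union>k\<le>n. F k)" for n
  have D: "D n \<in> ?A" for n
  proof -
    have "emeasure M (D n) \<le> (\<Sum>k\<le>n. emeasure M (F k))"
      unfolding D_def using F(1) by (intro emeasure_subadditive_finite) auto
    also have "\<dots> < \<infinity>" using F(1) by (auto simp: less_top[symmetric])
    finally show ?thesis using F(1) unfolding D_def by (auto intro!: sets.finite_UN)
  qed
  have inc: "incseq D" unfolding D_def by (force simp: incseq_def)
  have sD: "(SUP n. emeasure N (D n \<union> G)) = emeasure N ((\<Union>n. D n) \<union> G)" if "G \<in> sets M" for G
  proof -
    have "(SUP n. emeasure N (D n \<union> G)) = emeasure N (\<Union>n. D n \<union> G)"
      using D that N monoD[OF inc] by (intro SUP_emeasure_incseq monoI Un_mono) auto
    then show ?thesis by (simp add: UN_simps)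
  qed
  have Dsets: "(\<Union>n. D n) \<in> sets M" using D by blast
  have s_le: "s \<le> emeasure N (\<Union>n. D n)"
    unfolding f(2) F(2) using Dsets N by (intro SUP_least emeasure_mono) (auto simp: D_def)
  show "emeasure N E \<le> s"
  proof (rule ccontr)
    assume less: "\<not> emeasure N E \<le> s"
    have eq: "emeasure N (\<Union>n. D n) = s"
    proof (rule antisym[OF _ s_le])
      show "emeasure N (\<Union>n. D n) \<le> s"
        using sD[of "{}"] SUP_least[of UNIV "\<lambda>n. emeasure N (D n)", OF ub[OF D]] by simp
    qed
    have "emeasure N E \<le> emeasure N ((\<Union>n. D n) \<union> (E - (\<Union>n. D n)))"
      using E Dsets N by (intro emeasure_mono) auto
    also have "\<dots> \<le> s + emeasure N (E - (\<Union>n. D n))"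
      using E Dsets N unfolding eq[symmetric] by (intro emeasure_subadditive) auto
    finally have "0 < emeasure N (E - (\<Union>n. D n))"
      using less by (auto simp: zero_less_iff_neq_zero)
    then obtain G where G: "G \<in> sets M" "G \<subseteq> E - (\<Union>n. D n)" "emeasure M G < \<infinity>"
        "0 < emeasure N G"
      using rs E Dsets unfolding rel_semifinite_def by blast
    \<comment> \<open>The union of all \<open>D n\<close> may have infinite
      \<open>M\<close>-measure, so the bound is obtained for each \<open>D n \<union> G\<close> and
      then passed to the limit.\<close>
    have "emeasure N (D n \<union> G) \<le> s" for n
    proof (rule ub)
      have "emeasure M (D n \<union> G) \<le> emeasure M (D n) + emeasure M G"
        using D G by (intro emeasure_subadditive) auto
      also have "\<dots> < \<infinity>" using D[of n] G by auto
      finally show "D n \<union> G \<in> ?A" using D[of n] G by auto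
    qed
    then have "emeasure N ((\<Union>n. D n) \<union> G) \<le> s"
      unfolding sD[OF G(1), symmetric] by (rule SUP_least)
    moreover have "emeasure N ((\<Union>n. D n) \<union> G) = s + emeasure N G"
      unfolding eq[symmetric] using G Dsets N by (intro plus_emeasure[symmetric]) auto
    ultimately have "s + emeasure N G \<le> s + 0" by simp
    \<comment> \<open>Cancelling \<open>s\<close> is legitimate because \<open>s\<close> lies
      strictly below \<open>emeasure N E\<close> and is therefore finite.\<close>
    then show False
      using G(4) less by (subst (asm) ennreal_add_left_cancel_le) (auto simp: top_unique)
  qed
qed

text \<open>If \<open>y\<close> is the supremum of a chain along which the integrals over \<open>F\<close> tend to
  \<open>sup\<^sub>i \<integral>\<^sub>F v\<^sub>i\<close>, then \<open>max (v\<^sub>i) y\<close> has the same integral as \<open>y\<close> for every \<open>i\<close>, whence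
  \<open>v\<^sub>i \<le> y\<close> almost everywhere on \<open>F\<close>.\<close>

lemma directed_ess_sup_chain:
  fixes v :: "'i \<Rightarrow> 'a \<Rightarrow> ennreal"
  assumes dir: "directed_index I r"
    and v: "\<And>i. i \<in> I \<Longrightarrow> v i \<in> borel_measurable M"
    and mono: "\<And>i j. i \<in> I \<Longrightarrow> j \<in> I \<Longrightarrow> r i j \<Longrightarrow> AE t in M. v i t \<le> v j t"
    and bd: "\<And>i. i \<in> I \<Longrightarrow> (\<integral>\<^sup>+t. v i t \<partial>M) \<le> B" "B < \<infinity>"
  obtains j :: "nat \<Rightarrow> 'i" where "range j \<subseteq> I" "\<And>n. r (j n) (j (Suc n))"
    "\<And>i. i \<in> I \<Longrightarrow> AE t in M. v i t \<le> (SUP n. v (j n) t)"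
proof -
  have ne: "I \<noteq> {}" and ub: "\<And>i j. i \<in> I \<Longrightarrow> j \<in> I \<Longrightarrow> \<exists>k\<in>I. r i k \<and> r j k"
    using dir unfolding directed_index_def by blast+
  define s where "s = (SUP i\<in>I. \<integral>\<^sup>+t. v i t \<partial>M)"
  have s: "s < \<infinity>" unfolding s_def using bd by (meson SUP_least order.strict_trans1)
  from ennreal_SUP_countable_SUP[OF ne, of "\<lambda>i. \<integral>\<^sup>+t. v i t \<partial>M"] obtain f where
    f: "range f \<subseteq> (\<lambda>i. \<integral>\<^sup>+t. v i t \<partial>M) ` I" "s = (SUP n::nat. f n)"
    unfolding s_def by blast
  then have "\<forall>n. \<exists>i. i \<in> I \<and> f n = (\<integral>\<^sup>+t. v i t \<partial>M)" by blast
  then obtain k where "\<forall>n. k n \<in> I \<and> f n = (\<integral>\<^sup>+t. v (k n) t \<partial>M)" by (rule choice[THEN exE])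
  then have k: "\<And>n. k n \<in> I" "\<And>n. f n = (\<integral>\<^sup>+t. v (k n) t \<partial>M)" by blast+
  \<comment> \<open>Each \<open>j n\<close> dominates \<open>k n\<close>, so the integrals along
    \<open>j\<close> still reach \<open>s\<close>, and also the preceding \<open>j\<close>, which
    makes it a chain.\<close>
  have "\<exists>j. \<forall>n. (j n \<in> I \<and> r (k n) (j n)) \<and> r (j n) (j (Suc n))"
  proof (rule dependent_nat_choice)
    show "\<exists>x. x \<in> I \<and> r (k 0) x" using ub[OF k(1) k(1)] by blast
    show "\<exists>y. (y \<in> I \<and> r (k (Suc n)) y) \<and> r x y" if "x \<in> I \<and> r (k n) x" for x n
      using ub[of "k (Suc n)" x] k(1) that by blast
  qed
  then obtain j where j: "\<And>n. j n \<in> I" "\<And>n. r (k n) (j n)" "\<And>n. r (j n) (j (Suc n))"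
    by blast
  have [measurable]: "v (j n) \<in> borel_measurable M" for n by (rule v[OF j(1)])
  have incj: "AE t in M. v (j n) t \<le> v (j (Suc n)) t" for n
    by (rule mono[OF j(1) j(1) j(3)])
  have int_y: "(\<integral>\<^sup>+t. (SUP n. v (j n) t) \<partial>M) = s"
  proof -
    have "(\<integral>\<^sup>+t. (SUP n. v (j n) t) \<partial>M) = (SUP n. \<integral>\<^sup>+t. v (j n) t \<partial>M)"
      by (rule nn_integral_monotone_convergence_SUP_AE) (use incj in simp_all)
    also have "\<dots> = s"
    proof (rule antisym)
      show "(SUP n. \<integral>\<^sup>+t. v (j n) t \<partial>M) \<le> s"
        unfolding s_def by (intro SUP_least SUP_upper j(1))
      show "s \<le> (SUP n. \<integral>\<^sup>+t. v (j n) t \<partial>M)"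
        unfolding f(2) k(2)
      proof (rule SUP_mono, rule bexI)
        fix n
        show "(\<integral>\<^sup>+t. v (k n) t \<partial>M) \<le> (\<integral>\<^sup>+t. v (j n) t \<partial>M)"
          by (rule nn_integral_mono_AE[OF mono[OF k(1) j(1,2)]])
      qed simp
    qed
    finally show ?thesis .
  qed
  have "AE t in M. v i t \<le> (SUP n. v (j n) t)" if i: "i \<in> I" for i
  proof -
    have [measurable]: "v i \<in> borel_measurable M" by (rule v[OF i])
    define y where "y t = (SUP n. v (j n) t)" for t
    \<comment> \<open>\<open>z\<close> is the maximum of \<open>v i\<close> and \<open>y\<close>,
      written as a supremum of an increasing sequence. Each term is dominated by some member of the
      net, so its integral is at most \<open>s\<close>.\<close>
    define z where "z t = (SUP n. max (v i t) (v (j n) t))" for t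
    have [measurable]: "y \<in> borel_measurable M" "z \<in> borel_measurable M"
      unfolding y_def z_def by measurable
    have le: "y t \<le> z t" "v i t \<le> z t" for t
      unfolding y_def z_def
      by (rule SUP_mono, rule bexI, rule max.cobounded2, simp) (rule SUP_upper2[of 0], auto)
    have "(\<integral>\<^sup>+t. z t \<partial>M) = (SUP n. \<integral>\<^sup>+t. max (v i t) (v (j n) t) \<partial>M)"
      unfolding z_def
    proof (rule nn_integral_monotone_convergence_SUP_AE)
      show "AE t in M. max (v i t) (v (j n) t) \<le> max (v i t) (v (j (Suc n)) t)" for n
        using incj[of n] by eventually_elim (auto simp: max_def)
    qed simp
    also have "\<dots> \<le> s"
    proof (rule SUP_least)
      fix n
      obtain l where l: "l \<in> I" "r i l" "r (j n) l" using ub[OF i j(1)] by blast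
      have "(\<integral>\<^sup>+t. max (v i t) (v (j n) t) \<partial>M) \<le> (\<integral>\<^sup>+t. v l t \<partial>M)"
      proof (rule nn_integral_mono_AE)
        show "AE t in M. max (v i t) (v (j n) t) \<le> v l t"
          using mono[OF i l(1,2)] mono[OF j(1) l(1,3)] by eventually_elim simp
      qed
      also have "\<dots> \<le> s" unfolding s_def by (rule SUP_upper[OF l(1)])
      finally show "(\<integral>\<^sup>+t. max (v i t) (v (j n) t) \<partial>M) \<le> s" .
    qed
    finally have int_z: "(\<integral>\<^sup>+t. z t \<partial>M) \<le> s" .
    have int_y': "(\<integral>\<^sup>+t. y t \<partial>M) = s" using int_y by (simp add: y_def)
    have "(\<integral>\<^sup>+t. z t - y t \<partial>M) = (\<integral>\<^sup>+t. z t \<partial>M) - (\<integral>\<^sup>+t. y t \<partial>M)"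
      using s le int_y' by (intro nn_integral_diff) auto
    also have "\<dots> = 0" using int_z int_y' s by (simp add: diff_eq_0_iff_ennreal)
    finally have "AE t in M. z t - y t = 0"
      by (subst (asm) nn_integral_0_iff_AE) auto
    moreover have "AE t in M. y t \<noteq> \<infinity>"
      using int_y' s by (intro nn_integral_noteq_infinite) auto
    ultimately have "AE t in M. v i t \<le> y t"
    proof eventually_elim
      case (elim t)
      then have "z t \<le> y t" by (auto simp: diff_eq_0_iff_ennreal)
      then show ?case using le(2)[of t] by (rule order.trans[rotated])
    qed
    then show ?thesis by (simp add: y_def)
  qed
  then show ?thesis using that[of j] j by blast
qed

section \<open>Gluing densities along suprema of projections\<close>

lemma star_le_indicator_iff:
  assumes "A \<in> sets M" "B \<in> sets M"
  shows "star_le (Linf M) (Linf_class M (indicator A)) (Linf_class M (indicator B)) \<longleftrightarrow>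
    (AE t in M. t \<in> A \<longrightarrow> t \<in> B)"
proof -
  have "Im (indicator A t) = Im (indicator B t) \<and> Re (indicator A t) \<le> Re (indicator B t) \<longleftrightarrow>
      (t \<in> A \<longrightarrow> t \<in> B)" for t
    by (auto simp: indicator_def)
  then show ?thesis
    using assms by (simp add: star_le_Linf_iff Linf_funs_indicator)
qed

text \<open>Reads a supremum of projections as an essential supremum of sets. The almost-everywhere
  quantifier stays inside the quantifier over \<open>i\<close>: the null set may depend on
  \<open>i\<close>, which is what allows uncountable nets.\<close>

lemma dedekind_ess_sup:
  assumes ded: "dedekind M" and dir: "directed_index I r"
    and A: "\<And>i. i \<in> I \<Longrightarrow> A i \<in> sets M"
    and mono: "\<And>i j. i \<in> I \<Longrightarrow> j \<in> I \<Longrightarrow> r i j \<Longrightarrow> AE t in M. t \<in> A i \<longrightarrow> t \<in> A j"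
  obtains S where "S \<in> sets M" "\<And>i. i \<in> I \<Longrightarrow> AE t in M. t \<in> A i \<longrightarrow> t \<in> S"
    "\<And>G. G \<in> sets M \<Longrightarrow> (\<And>i. i \<in> I \<Longrightarrow> AE t in M. t \<in> A i \<longrightarrow> t \<in> G) \<Longrightarrow>
       AE t in M. t \<in> S \<longrightarrow> t \<in> G"
proof -
  define c where "c E = Linf_class M (indicator E)" for E
  have le: "star_le (Linf M) (c E) (c F) \<longleftrightarrow> (AE t in M. t \<in> E \<longrightarrow> t \<in> F)"
    if "E \<in> sets M" "F \<in> sets M" for E F
    unfolding c_def using that by (rule star_le_indicator_iff)
  have carr: "carrier (proj_order (Linf M)) = c ` sets M"
    "gorder.le (proj_order (Linf M)) = star_le (Linf M)"
    unfolding c_def by (auto simp: proj_order_def projections_Linf)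
  have "increasing_net (proj_order (Linf M)) I r (\<lambda>i. c (A i))"
    unfolding increasing_net_def carr using dir A mono le by auto
  from dedekind_any_net[OF ded this] obtain s where
    s: "least (proj_order (Linf M)) s (Upper (proj_order (Linf M)) ((\<lambda>i. c (A i)) ` I))" by blast
  then have "s \<in> c ` sets M" by (auto simp: least_def Upper_def carr)
  then obtain S where S: "S \<in> sets M" "s = c S" by blast
  show ?thesis
  proof (rule that[OF S(1)])
    show "AE t in M. t \<in> A i \<longrightarrow> t \<in> S" if "i \<in> I" for i
    proof -
      have "star_le (Linf M) (c (A i)) s"
        using s that A[OF that] by (auto simp: least_def Upper_def carr)
      then show ?thesis using le[OF A[OF that] S(1)] S by simp
    qed
  next
    fix G assume G: "G \<in> sets M" "\<And>i. i \<in> I \<Longrightarrow> AE t in M. t \<in> A i \<longrightarrow> t \<in> G"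
    have "c G \<in> Upper (proj_order (Linf M)) ((\<lambda>i. c (A i)) ` I)"
      using G A le by (auto simp: Upper_def carr)
    then have "star_le (Linf M) s (c G)" using s by (auto simp: least_def carr)
    then show "AE t in M. t \<in> S \<longrightarrow> t \<in> G" using le S G(1) by simp
  qed
qed

text \<open>Both measures are cut down to \<open>F\<close> by densities with
  \<open>indicator F\<close>, so that the base is finite; \<open>g\<close> may take the value
  infinity.\<close>

lemma density_on_finite_set:
  assumes ac: "absolutely_continuous M N" and N: "sets N = sets M"
    and F: "F \<in> sets M" "emeasure M F < \<infinity>"
  obtains g where "g \<in> borel_measurable M"
    "\<And>E. E \<in> sets M \<Longrightarrow> E \<subseteq> F \<Longrightarrow> emeasure N E = (\<integral>\<^sup>+t\<in>E. g t \<partial>M)"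
proof -
  have [measurable]: "F \<in> sets M" "F \<in> sets N" using F N by auto
  interpret finite_measure "density M (indicator F)"
    by (rule finite_measure_density_indicator[OF F])
  have "absolutely_continuous (density M (indicator F)) (density N (indicator F))"
    unfolding absolutely_continuous_def
  proof
    fix E assume "E \<in> null_sets (density M (indicator F))"
    then have E: "E \<in> sets M" "emeasure M (F \<inter> E) = 0"
      by (auto simp: null_sets_def emeasure_restricted)
    then have "emeasure N (F \<inter> E) = 0"
      using absolutely_continuous_emeasure_0[OF ac] F by auto
    then show "E \<in> null_sets (density N (indicator F))"
      using E N by (auto simp: null_sets_def emeasure_restricted)
  qed
  from Radon_Nikodym[OF this] N obtain g where
    g: "g \<in> borel_measurable (density M (indicator F))"
      "density (density M (indicator F)) g = density N (indicator F)"
    by auto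
  then have [measurable]: "g \<in> borel_measurable M" by simp
  show ?thesis
  proof (rule that)
    fix E assume E: "E \<in> sets M" "E \<subseteq> F"
    then have [measurable]: "E \<in> sets M" "E \<in> sets N" using N by auto
    have "emeasure N E = emeasure (density N (indicator F)) E"
      using E by (simp add: emeasure_restricted Int_absorb1)
    also have "\<dots> = emeasure (density (density M (indicator F)) g) E" using g by simp
    also have "\<dots> = (\<integral>\<^sup>+t. indicator F t * g t * indicator E t \<partial>M)"
      by (simp add: density_density_eq emeasure_density)
    also have "\<dots> = (\<integral>\<^sup>+t\<in>E. g t \<partial>M)"
      using E by (intro nn_integral_cong) (auto simp: indicator_def)
    finally show "emeasure N E = (\<integral>\<^sup>+t\<in>E. g t \<partial>M)" .
  qed simp
qed

text \<open>Rebuilds a value from its strict rational lower cut. The default 0 is the bottom element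
  and does not change the supremum; for \<open>x = 0\<close> no rational qualifies and only defaults
  remain.\<close>

lemma SUP_rat_below_ennreal:
  "(SUP q::rat. if ennreal (of_rat q) < x then ennreal (of_rat q) else 0) = x"
proof (rule antisym)
  show "x \<le> (SUP q::rat. if ennreal (of_rat q) < x then ennreal (of_rat q) else 0)"
  proof (rule dense_le)
    fix y assume "y < x"
    then obtain q where q: "y < ennreal (real_of_rat q)" "ennreal (real_of_rat q) < x"
      using ennreal_rat_dense by blast
    then show "y \<le> (SUP q::rat. if ennreal (of_rat q) < x then ennreal (of_rat q) else 0)"
      by (intro SUP_upper2[of q]) auto
  qed
qed (rule SUP_least, simp add: less_imp_le)

text \<open>The densities \<open>g F\<close> on the sets \<open>F\<close> of finite measure are glued along their superlevel
  sets \<open>{t \<in> F. q < g F t}\<close>: for each rational \<open>q\<close> these increase with \<open>F\<close>, and on \<open>F\<close> their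
  supremum in the lattice of projections is the one belonging to \<open>F\<close>.\<close>

lemma rel_semifinite_imp_has_density:
  assumes sf: "semifinite M" and ded: "dedekind M"
    and N: "sets N = sets M" and ac: "absolutely_continuous M N" and rs: "rel_semifinite M N"
  shows "\<exists>h. has_density M N h"
proof -
  define Fin where "Fin = {F \<in> sets M. F \<subseteq> space M \<and> emeasure M F < \<infinity>}"
  have Fin: "F \<in> sets M" "emeasure M F < \<infinity>" if "F \<in> Fin" for F
    using that by (auto simp: Fin_def)
  have "\<forall>F\<in>Fin. \<exists>g. g \<in> borel_measurable M \<and>
      (\<forall>E\<in>sets M. E \<subseteq> F \<longrightarrow> emeasure N E = (\<integral>\<^sup>+t\<in>E. g t \<partial>M))"
  proof
    fix F assume "F \<in> Fin"
    then show "\<exists>g. g \<in> borel_measurable M \<and>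
        (\<forall>E\<in>sets M. E \<subseteq> F \<longrightarrow> emeasure N E = (\<integral>\<^sup>+t\<in>E. g t \<partial>M))"
      using density_on_finite_set[OF ac N Fin] by metis
  qed
  then obtain g where "\<forall>F\<in>Fin. g F \<in> borel_measurable M \<and>
      (\<forall>E\<in>sets M. E \<subseteq> F \<longrightarrow> emeasure N E = (\<integral>\<^sup>+t\<in>E. g F t \<partial>M))"
    by (rule bchoice[THEN exE])
  then have g: "\<And>F. F \<in> Fin \<Longrightarrow> g F \<in> borel_measurable M"
    "\<And>F E. F \<in> Fin \<Longrightarrow> E \<in> sets M \<Longrightarrow> E \<subseteq> F \<Longrightarrow> emeasure N E = (\<integral>\<^sup>+t\<in>E. g F t \<partial>M)"
    by blast+
  have g_eq: "AE t in M. t \<in> F \<inter> F' \<longrightarrow> g F t = g F' t" if F: "F \<in> Fin" "F' \<in> Fin" for F F'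
  proof (rule density_unique_on)
    show "F \<inter> F' \<in> sets M" using F by (auto dest: Fin)
    have "emeasure M (F \<inter> F') \<le> emeasure M F" using F by (intro emeasure_mono) (auto dest: Fin)
    then show "emeasure M (F \<inter> F') < \<infinity>" using Fin(2)[OF F(1)] by (rule order.strict_trans1)
    show "(\<integral>\<^sup>+t\<in>E. g F t \<partial>M) = (\<integral>\<^sup>+t\<in>E. g F' t \<partial>M)" if "E \<in> sets M" "E \<subseteq> F \<inter> F'" for E
      using g(2)[OF F(1) that(1)] g(2)[OF F(2) that(1)] that(2) by auto
  qed (use g F in auto)
  define A where "A q F = {t \<in> space M. t \<in> F \<and> ennreal (real_of_rat q) < g F t}" for q F
  have A: "A q F \<in> sets M" if "F \<in> Fin" for q F
  proof -
    have [measurable]: "F \<in> sets M" "g F \<in> borel_measurable M" using that g Fin by auto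
    show ?thesis unfolding A_def by measurable
  qed
  have dir: "directed_index Fin (\<subseteq>)"
    unfolding Fin_def by (rule directed_finite_measure_subsets)
  have A_mono: "AE t in M. t \<in> A q F \<longrightarrow> t \<in> A q F'" if F: "F \<in> Fin" "F' \<in> Fin" "F \<subseteq> F'" for q F F'
    using g_eq[OF F(1,2)] by eventually_elim (use F(3) in \<open>auto simp: A_def\<close>)
  have "\<exists>S. S \<in> sets M \<and> (\<forall>F\<in>Fin. AE t in M. t \<in> F \<longrightarrow> t \<in> S \<longleftrightarrow> ennreal (real_of_rat q) < g F t)"
    for q
  proof -
    obtain S where S: "S \<in> sets M" "\<And>F. F \<in> Fin \<Longrightarrow> AE t in M. t \<in> A q F \<longrightarrow> t \<in> S"
      "\<And>G. G \<in> sets M \<Longrightarrow> (\<And>F. F \<in> Fin \<Longrightarrow> AE t in M. t \<in> A q F \<longrightarrow> t \<in> G) \<Longrightarrow>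
         AE t in M. t \<in> S \<longrightarrow> t \<in> G"
      by (rule dedekind_ess_sup[OF ded dir, of "A q" thesis]) (use A A_mono in auto)
    have "AE t in M. t \<in> F \<longrightarrow> t \<in> S \<longleftrightarrow> ennreal (real_of_rat q) < g F t" if F: "F \<in> Fin" for F
    proof -
      \<comment> \<open>\<open>G\<close> removes from \<open>S\<close> its excess over
        \<open>A q F\<close> inside \<open>F\<close>. On \<open>F\<close> every
        \<open>A q F'\<close> lies in \<open>A q F\<close> up to a null set, so \<open>G\<close> is
        still an upper bound, and minimality of \<open>S\<close> shows the excess to be
        null.\<close>
      define G where "G = S - (F - A q F)"
      have "AE t in M. t \<in> S \<longrightarrow> t \<in> G"
      proof (rule S(3))
        show "G \<in> sets M" unfolding G_def using S(1) A[OF F] Fin(1)[OF F] by auto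
        show "AE t in M. t \<in> A q F' \<longrightarrow> t \<in> G" if F': "F' \<in> Fin" for F'
          using S(2)[OF F'] g_eq[OF F F']
          by eventually_elim (auto simp: G_def A_def)
      qed
      then show ?thesis
        using S(2)[OF F] AE_space by eventually_elim (auto simp: G_def A_def)
    qed
    then show ?thesis using S(1) by blast
  qed
  then have "\<forall>q. \<exists>S. S \<in> sets M \<and> (\<forall>F\<in>Fin. AE t in M. t \<in> F \<longrightarrow>
      t \<in> S \<longleftrightarrow> ennreal (real_of_rat q) < g F t)" by blast
  then obtain S where "\<forall>q. S q \<in> sets M \<and> (\<forall>F\<in>Fin. AE t in M. t \<in> F \<longrightarrow>
      t \<in> S q \<longleftrightarrow> ennreal (real_of_rat q) < g F t)" by (rule choice[THEN exE])
  then have S[measurable]: "\<And>q. S q \<in> sets M" and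
    S': "\<And>q F. F \<in> Fin \<Longrightarrow> AE t in M. t \<in> F \<longrightarrow> t \<in> S q \<longleftrightarrow> ennreal (real_of_rat q) < g F t"
    by blast+
  define h where "h t = (SUP q::rat. if t \<in> S q then ennreal (real_of_rat q) else 0)" for t
  have h[measurable]: "h \<in> borel_measurable M"
    unfolding h_def by (intro borel_measurable_SUP) auto
  have h_eq: "AE t in M. t \<in> F \<longrightarrow> h t = g F t" if F: "F \<in> Fin" for F
  proof -
    \<comment> \<open>With rational levels, one null set serves all \<open>q\<close> at once for the
      given \<open>F\<close>.\<close>
    have "AE t in M. \<forall>q. t \<in> F \<longrightarrow> t \<in> S q \<longleftrightarrow> ennreal (real_of_rat q) < g F t"
      unfolding AE_all_countable using S'[OF F] by blast
    then show ?thesis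
    proof eventually_elim
      case (elim t)
      show ?case
      proof
        assume "t \<in> F"
        with elim have "h t = (SUP q::rat. if ennreal (of_rat q) < g F t then ennreal (of_rat q) else 0)"
          unfolding h_def by simp
        then show "h t = g F t" by (simp only: SUP_rat_below_ennreal)
      qed
    qed
  qed
  have dF: "emeasure (density M h) F = emeasure N F" if F: "F \<in> Fin" for F
  proof -
    have "emeasure (density M h) F = (\<integral>\<^sup>+t\<in>F. h t \<partial>M)"
      by (rule emeasure_density[OF h Fin(1)[OF F]])
    also have "\<dots> = (\<integral>\<^sup>+t\<in>F. g F t \<partial>M)"
      using h_eq[OF F] by (intro nn_integral_cong_AE) (auto elim!: AE_mp simp: indicator_def)
    also have "\<dots> = emeasure N F"
      by (rule g(2)[OF F Fin(1)[OF F] order.refl, symmetric])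
    finally show ?thesis .
  qed
  have "density M h = N"
  proof (rule measure_eqI)
    fix E assume "E \<in> sets (density M h)"
    then have E: "E \<in> sets M" by simp
    \<comment> \<open>Both sides are suprema over subsets of finite \<open>M\<close>-measure, where
      they agree by \<open>dF\<close>.\<close>
    show "emeasure (density M h) E = emeasure N E"
      unfolding rel_semifinite_emeasure_SUP[OF rs N E]
        rel_semifinite_emeasure_SUP[OF rel_semifinite_density[OF sf h] sets_density E]
      by (intro SUP_cong refl dF) (use sets.sets_into_space[OF E] in \<open>auto simp: Fin_def\<close>)
  qed (simp add: N)
  then show ?thesis using h has_density_iff[OF N] by blast
qed

section \<open>Normal weights\<close>

text \<open>Nonnegativity is required on the whole type, as the induction principle
  \<open>borel_measurable_induct_real\<close> has it, but its approximating sequences are controlled on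
  \<open>space M\<close> only, and so is boundedness.\<close>

definition nonneg_bounded :: "'a measure \<Rightarrow> ('a \<Rightarrow> real) set" where
  "nonneg_bounded M = {u \<in> borel_measurable M. (\<forall>t. 0 \<le> u t) \<and> (\<exists>C. \<forall>t\<in>space M. u t \<le> C)}"

definition real_class :: "'a measure \<Rightarrow> ('a \<Rightarrow> real) \<Rightarrow> ('a \<Rightarrow> complex) set" where
  "real_class M u = Linf_class M (\<lambda>t. complex_of_real (u t))"

lemma nonneg_bounded_Linf_funs:
  assumes "u \<in> nonneg_bounded M"
  shows "(\<lambda>t. complex_of_real (u t)) \<in> Linf_funs M"
proof -
  obtain C where C: "\<And>t. t \<in> space M \<Longrightarrow> u t \<le> C" and u: "\<And>t. 0 \<le> u t" "u \<in> borel_measurable M"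
    using assms by (auto simp: nonneg_bounded_def)
  have "AE t in M. cmod (complex_of_real (u t)) \<le> C"
    using C u by (intro AE_I2) simp
  then show ?thesis using u by (auto simp: Linf_funs_def)
qed

lemma nonneg_bounded_indicator: "E \<in> sets M \<Longrightarrow> indicator E \<in> nonneg_bounded M"
  by (auto simp: nonneg_bounded_def intro!: exI[of _ 1] split: split_indicator)

lemma nonneg_bounded_add:
  assumes "u \<in> nonneg_bounded M" "v \<in> nonneg_bounded M"
  shows "(\<lambda>t. u t + v t) \<in> nonneg_bounded M"
proof -
  obtain C where "\<And>t. t \<in> space M \<Longrightarrow> u t \<le> C"
    using assms(1) by (auto simp: nonneg_bounded_def)
  moreover obtain D where "\<And>t. t \<in> space M \<Longrightarrow> v t \<le> D"
    using assms(2) by (auto simp: nonneg_bounded_def)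
  ultimately have "\<And>t. t \<in> space M \<Longrightarrow> u t + v t \<le> C + D" by (intro add_mono)
  then show ?thesis using assms by (auto simp: nonneg_bounded_def)
qed

lemma nonneg_bounded_mult:
  assumes "u \<in> nonneg_bounded M" "0 \<le> c"
  shows "(\<lambda>t. c * u t) \<in> nonneg_bounded M"
proof -
  from assms obtain C where "\<And>t. t \<in> space M \<Longrightarrow> u t \<le> C"
    by (auto simp: nonneg_bounded_def)
  then have "\<And>t. t \<in> space M \<Longrightarrow> c * u t \<le> c * C" using assms(2) by (intro mult_left_mono)
  then show ?thesis using assms by (auto simp: nonneg_bounded_def)
qed

lemma pos_cone_Linf_eq: "pos_cone (Linf M) = real_class M ` nonneg_bounded M"
proof safe
  fix u assume "u \<in> nonneg_bounded M"
  then show "real_class M u \<in> pos_cone (Linf M)"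
    unfolding real_class_def
    by (subst pos_cone_Linf_iff) (auto simp: nonneg_bounded_Linf_funs, auto simp: nonneg_bounded_def)
next
  fix a assume a: "a \<in> pos_cone (Linf M)"
  then obtain f where f: "f \<in> Linf_funs M" "a = Linf_class M f"
    using carrier_Linf_rep pos_cone_Linf_subset by blast
  then have [measurable]: "f \<in> borel_measurable M" by (simp add: Linf_funs_def)
  from f obtain C where C: "AE t in M. cmod (f t) \<le> C" by (auto simp: Linf_funs_def)
  \<comment> \<open>Truncation turns almost-everywhere bounds into bounds everywhere. The absolute
    value is taken because \<open>C\<close> may be negative when the whole space is null.\<close>
  define u where "u t = max 0 (min \<bar>C\<bar> (Re (f t)))" for t
  have u: "u \<in> nonneg_bounded M"
    unfolding nonneg_bounded_def u_def by (auto intro!: exI[of _ "\<bar>C\<bar>"])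
  have "AE t in M. Im (f t) = 0 \<and> 0 \<le> Re (f t)"
    using a f by (simp add: pos_cone_Linf_iff)
  then have "AE t in M. f t = complex_of_real (u t)"
    using C
  proof eventually_elim
    case (elim t)
    then have "Re (f t) \<le> \<bar>C\<bar>" using complex_Re_le_cmod[of "f t"] by linarith
    then show ?case using elim by (auto simp: u_def complex_eq_iff)
  qed
  then have "a = real_class M u"
    using f u by (simp add: real_class_def Linf_class_eq_iff nonneg_bounded_Linf_funs)
  then show "a \<in> real_class M ` nonneg_bounded M" using u by blast
qed

lemma star_le_real_class:
  assumes "u \<in> nonneg_bounded M" "v \<in> nonneg_bounded M"
  shows "star_le (Linf M) (real_class M u) (real_class M v) \<longleftrightarrow> (AE t in M. u t \<le> v t)"
  unfolding real_class_def by (simp add: star_le_Linf_iff nonneg_bounded_Linf_funs assms)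

lemma real_class_cong_AE:
  assumes "u \<in> nonneg_bounded M" "v \<in> nonneg_bounded M" "AE t in M. u t = v t"
  shows "real_class M u = real_class M v"
  using assms by (simp add: real_class_def Linf_class_eq_iff nonneg_bounded_Linf_funs)

lemma add_real_class:
  assumes "u \<in> nonneg_bounded M" "v \<in> nonneg_bounded M"
  shows "real_class M u \<oplus>\<^bsub>Linf M\<^esub> real_class M v = real_class M (\<lambda>t. u t + v t)"
  unfolding real_class_def by (simp add: Linf_add_class nonneg_bounded_Linf_funs assms)

lemma smult_real_class:
  assumes "u \<in> nonneg_bounded M"
  shows "complex_of_real c \<odot>\<^bsub>Linf M\<^esub> real_class M u = real_class M (\<lambda>t. c * u t)"
  unfolding real_class_def by (simp add: Linf_smult_class nonneg_bounded_Linf_funs assms)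

lemma int_weight_real_class:
  assumes "u \<in> nonneg_bounded M" "sets N = sets M" "absolutely_continuous M N"
  shows "int_weight N (real_class M u) = (\<integral>\<^sup>+t. ennreal (u t) \<partial>N)"
  unfolding real_class_def by (simp add: int_weight_class nonneg_bounded_Linf_funs assms)

lemma increasing_net_real_class:
  assumes "\<And>i. i \<in> I \<Longrightarrow> v i \<in> nonneg_bounded M"
  shows "increasing_net (pos_order (Linf M)) I r (\<lambda>i. real_class M (v i)) \<longleftrightarrow>
    directed_index I r \<and> (\<forall>i\<in>I. \<forall>j\<in>I. r i j \<longrightarrow> (AE t in M. v i t \<le> v j t))"
  using assms by (auto simp: increasing_net_def pos_order_def pos_cone_Linf_eq star_le_real_class)

text \<open>Every element of the cone has a representative in \<open>nonneg_bounded M\<close>, so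
  least upper bounds can be tested on such functions by inequalities almost everywhere.\<close>

lemma least_Upper_real_class:
  assumes v: "\<And>i. i \<in> I \<Longrightarrow> v i \<in> nonneg_bounded M" and s: "s \<in> nonneg_bounded M"
  shows "least (pos_order (Linf M)) (real_class M s)
      (Upper (pos_order (Linf M)) ((\<lambda>i. real_class M (v i)) ` I)) \<longleftrightarrow>
    (\<forall>i\<in>I. AE t in M. v i t \<le> s t) \<and>
    (\<forall>w\<in>nonneg_bounded M. (\<forall>i\<in>I. AE t in M. v i t \<le> w t) \<longrightarrow> (AE t in M. s t \<le> w t))"
proof -
  let ?U = "Upper (pos_order (Linf M)) ((\<lambda>i. real_class M (v i)) ` I)"
  have U: "real_class M w \<in> ?U \<longleftrightarrow> (\<forall>i\<in>I. AE t in M. v i t \<le> w t)"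
    if "w \<in> nonneg_bounded M" for w
    using v that by (auto simp: Upper_def pos_order_def pos_cone_Linf_eq star_le_real_class)
  have carr: "?U \<subseteq> real_class M ` nonneg_bounded M"
    by (auto simp: Upper_def pos_order_def pos_cone_Linf_eq)
  have "(\<forall>x\<in>?U. star_le (Linf M) (real_class M s) x) \<longleftrightarrow>
      (\<forall>w\<in>nonneg_bounded M. real_class M w \<in> ?U \<longrightarrow> star_le (Linf M) (real_class M s) (real_class M w))"
  proof (intro iffI ballI impI)
    fix x assume x: "x \<in> ?U"
    then obtain w where "w \<in> nonneg_bounded M" "x = real_class M w" using subsetD[OF carr] by blast
    moreover assume "\<forall>w\<in>nonneg_bounded M. real_class M w \<in> ?U \<longrightarrow>
      star_le (Linf M) (real_class M s) (real_class M w)"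
    ultimately show "star_le (Linf M) (real_class M s) x" using x by simp
  qed simp
  also have "\<dots> \<longleftrightarrow> (\<forall>w\<in>nonneg_bounded M. (\<forall>i\<in>I. AE t in M. v i t \<le> w t) \<longrightarrow> (AE t in M. s t \<le> w t))"
    using U s by (auto simp: star_le_real_class)
  finally show ?thesis
    using carr U[OF s] by (simp add: least_def pos_order_def pos_cone_Linf_eq)
qed

text \<open>On a set \<open>F\<close> of finite measure the least upper bound \<open>s\<close> is almost everywhere the supremum of
  a countable chain of the net, for otherwise it could be lowered on \<open>F\<close>; there monotone
  convergence applies.\<close>

lemma nn_integral_density_least_upper_bound:
  fixes v :: "'i \<Rightarrow> 'a \<Rightarrow> real"
  assumes sf: "semifinite M" and h[measurable]: "h \<in> borel_measurable M"
    and dir: "directed_index I r"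
    and v: "\<And>i. i \<in> I \<Longrightarrow> v i \<in> nonneg_bounded M"
    and mono: "\<And>i j. i \<in> I \<Longrightarrow> j \<in> I \<Longrightarrow> r i j \<Longrightarrow> AE t in M. v i t \<le> v j t"
    and s: "s \<in> nonneg_bounded M"
    and ub: "\<And>i. i \<in> I \<Longrightarrow> AE t in M. v i t \<le> s t"
    and least: "\<And>w. w \<in> nonneg_bounded M \<Longrightarrow> (\<And>i. i \<in> I \<Longrightarrow> AE t in M. v i t \<le> w t) \<Longrightarrow>
      AE t in M. s t \<le> w t"
  shows "(\<integral>\<^sup>+t. ennreal (s t) \<partial>density M h) = (SUP i\<in>I. \<integral>\<^sup>+t. ennreal (v i t) \<partial>density M h)"
proof (rule antisym)
  have ac: "absolutely_continuous M (density M h)"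
    using h by (rule absolutely_continuousI_density)
  have AE_dens: "AE t in density M h. P t" if "AE t in M. P t" for P
    by (rule absolutely_continuous_AE[OF sets_density ac that])
  show "(SUP i\<in>I. \<integral>\<^sup>+t. ennreal (v i t) \<partial>density M h) \<le> (\<integral>\<^sup>+t. ennreal (s t) \<partial>density M h)"
  proof (intro SUP_least nn_integral_mono_AE AE_dens)
    fix i assume "i \<in> I"
    from ub[OF this] show "AE t in M. ennreal (v i t) \<le> ennreal (s t)"
      by eventually_elim (rule ennreal_leI)
  qed
  have s_meas[measurable]: "s \<in> borel_measurable M" and s_nonneg: "\<And>t. 0 \<le> s t"
    using s by (auto simp: nonneg_bounded_def)
  obtain C where C: "\<And>t. t \<in> space M \<Longrightarrow> s t \<le> C" using s by (auto simp: nonneg_bounded_def)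
  define c where "c = (SUP i\<in>I. \<integral>\<^sup>+t. ennreal (v i t) \<partial>density M h)"
  \<comment> \<open>With \<open>s\<close> absorbed into the density, the integral of
    \<open>s\<close> becomes the total mass of \<open>P\<close>, which is the supremum of its values
    on sets of finite \<open>M\<close>-measure.\<close>
  define P where "P = density M (\<lambda>t. h t * ennreal (s t))"
  have P: "emeasure P E = (\<integral>\<^sup>+t\<in>E. ennreal (s t) \<partial>density M h)" if [measurable]: "E \<in> sets M" for E
    unfolding P_def by (simp add: emeasure_density nn_integral_density mult.assoc)
  have "emeasure P F \<le> c" if F: "F \<in> sets M" "emeasure M F < \<infinity>" for F
  proof -
    have [measurable]: "F \<in> sets M" by fact
    let ?MF = "density M (indicator F)"
    have AE_F: "(AE t in ?MF. Q t) \<longleftrightarrow> (AE t in M. t \<in> F \<longrightarrow> Q t)" for Q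
    proof -
      have "(AE t in ?MF. Q t) \<longleftrightarrow> (AE t in M. (0::ennreal) < indicator F t \<longrightarrow> Q t)"
        by (rule AE_density) simp
      then show ?thesis by (simp add: indicator_def)
    qed
    \<comment> \<open>The chain is selected by integrals against \<open>M\<close> over
      \<open>F\<close>, which are bounded by \<open>C\<close> times the measure of \<open>F\<close>;
      those against \<open>density M h\<close> could be infinite.\<close>
    obtain j :: "nat \<Rightarrow> 'i" where j: "range j \<subseteq> I" "\<And>n. r (j n) (j (Suc n))" and
      sup: "\<And>i. i \<in> I \<Longrightarrow> AE t in ?MF. ennreal (v i t) \<le> (SUP n. ennreal (v (j n) t))"
    proof (rule directed_ess_sup_chain[OF dir, of "\<lambda>i t. ennreal (v i t)" ?MF "ennreal C * emeasure M F"])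
      show "(\<lambda>t. ennreal (v i t)) \<in> borel_measurable ?MF" if "i \<in> I" for i
        using v[OF that] by (auto simp: nonneg_bounded_def)
      show "AE t in ?MF. ennreal (v i t) \<le> ennreal (v k t)" if "i \<in> I" "k \<in> I" "r i k" for i k
        using mono[OF that] unfolding AE_F by eventually_elim (simp add: ennreal_leI)
      show "(\<integral>\<^sup>+t. ennreal (v i t) \<partial>?MF) \<le> ennreal C * emeasure M F" if "i \<in> I" for i
      proof -
        have "(\<integral>\<^sup>+t. ennreal (v i t) \<partial>?MF) \<le> (\<integral>\<^sup>+t. ennreal C \<partial>?MF)"
        proof (rule nn_integral_mono_AE)
          show "AE t in ?MF. ennreal (v i t) \<le> ennreal C"
            using ub[OF that] AE_space unfolding AE_F
            by eventually_elim (intro impI, erule ennreal_leI[OF order.trans[OF _ C]])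
        qed
        also have "\<dots> = ennreal C * emeasure M F"
          by (simp add: emeasure_restricted)
        finally show ?thesis .
      qed
      show "ennreal C * emeasure M F < \<infinity>"
        using F(2) by (simp add: ennreal_mult_less_top)
    qed blast
    have jI: "j n \<in> I" for n using j(1) by blast
    have [measurable]: "v (j n) \<in> borel_measurable M" for n
      using v[OF jI] by (auto simp: nonneg_bounded_def)
    define y where "y t = (SUP n. ennreal (v (j n) t))" for t
    have [measurable]: "y \<in> borel_measurable M" unfolding y_def by measurable
    have y_le: "AE t in M. y t \<le> ennreal (s t)"
    proof -
      have "AE t in M. \<forall>n. v (j n) t \<le> s t" unfolding AE_all_countable using ub[OF jI] by blast
      then show ?thesis by eventually_elim (auto simp: y_def intro!: SUP_least ennreal_leI)
    qed
    \<comment> \<open>\<open>w\<close> lowers \<open>s\<close> to \<open>y\<close> on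
      \<open>F\<close> alone. It still dominates the net, so leastness of \<open>s\<close> forces
      \<open>s\<close> below \<open>y\<close> there.\<close>
    define w where "w t = (if t \<in> F then min (s t) (enn2real (y t)) else s t)" for t
    have "AE t in M. s t \<le> w t"
    proof (rule least)
      have "w t \<le> s t" for t by (simp add: w_def)
      then have "w t \<le> C" if "t \<in> space M" for t using C[OF that] order.trans by blast
      moreover have "w \<in> borel_measurable M" unfolding w_def by measurable
      ultimately show "w \<in> nonneg_bounded M"
        unfolding nonneg_bounded_def
        by (intro CollectI conjI allI exI[of _ C] ballI) (auto simp: w_def s_nonneg)
      show "AE t in M. v i t \<le> w t" if i: "i \<in> I" for i
        using sup[OF i] ub[OF i] y_le unfolding AE_F
      proof eventually_elim
        case (elim t)
        show ?case
        proof (cases "t \<in> F")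
          case True
          have "0 \<le> v i t" using v[OF i] by (simp add: nonneg_bounded_def)
          moreover have "ennreal (v i t) \<le> y t" "y t < \<infinity>"
            using elim True by (auto simp: y_def intro: order.strict_trans1)
          ultimately have "v i t \<le> enn2real (y t)"
            using enn2real_mono[of "ennreal (v i t)" "y t"] by simp
          then show ?thesis using elim True by (simp add: w_def)
        qed (use elim in \<open>simp add: w_def\<close>)
      qed
    qed
    then have "AE t in M. t \<in> F \<longrightarrow> ennreal (s t) \<le> y t"
      using y_le
    proof eventually_elim
      case (elim t)
      show ?case
      proof
        assume "t \<in> F"
        then have "s t \<le> enn2real (y t)" using elim by (simp add: w_def)
        then have "ennreal (s t) \<le> ennreal (enn2real (y t))" by (rule ennreal_leI)
        also have "\<dots> = y t"
          using order.strict_trans1[OF elim(2), of \<infinity>] by simp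
        finally show "ennreal (s t) \<le> y t" .
      qed
    qed
    then have "AE t in M. ennreal (s t) * indicator F t \<le> y t"
      by eventually_elim (auto simp: indicator_def)
    then have "AE t in density M h. ennreal (s t) * indicator F t \<le> y t" by (rule AE_dens)
    then have "emeasure P F \<le> (\<integral>\<^sup>+t. y t \<partial>density M h)"
      unfolding P[OF F(1)] by (rule nn_integral_mono_AE)
    also have "\<dots> = (SUP n. \<integral>\<^sup>+t. ennreal (v (j n) t) \<partial>density M h)"
      unfolding y_def
    proof (rule nn_integral_monotone_convergence_SUP_AE)
      show "AE t in density M h. ennreal (v (j n) t) \<le> ennreal (v (j (Suc n)) t)" for n
      proof (rule AE_dens)
        show "AE t in M. ennreal (v (j n) t) \<le> ennreal (v (j (Suc n)) t)"
          using mono[OF jI jI j(2)] by eventually_elim (rule ennreal_leI)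
      qed
    qed simp
    also have "\<dots> \<le> c" unfolding c_def by (intro SUP_least SUP_upper jI)
    finally show ?thesis .
  qed
  then have "(SUP F\<in>{F \<in> sets M. F \<subseteq> space M \<and> emeasure M F < \<infinity>}. emeasure P F) \<le> c"
    by (intro SUP_least) auto
  moreover have "rel_semifinite M P" unfolding P_def by (rule rel_semifinite_density[OF sf]) simp
  then have "emeasure P (space M) =
      (SUP F\<in>{F \<in> sets M. F \<subseteq> space M \<and> emeasure M F < \<infinity>}. emeasure P F)"
    by (rule rel_semifinite_emeasure_SUP) (auto simp: P_def)
  moreover have "emeasure P (space M) = (\<integral>\<^sup>+t. ennreal (s t) \<partial>density M h)"
    unfolding P[OF sets.top] by (intro nn_integral_cong) (simp add: indicator_def)
  ultimately show "(\<integral>\<^sup>+t. ennreal (s t) \<partial>density M h) \<le> (SUP i\<in>I. \<integral>\<^sup>+t. ennreal (v i t) \<partial>density M h)"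
    by (simp add: c_def)
qed

lemma weight_int_weight:
  assumes N: "sets N = sets M" and ac: "absolutely_continuous M N"
  shows "weight (Linf M) (int_weight N)"
proof -
  have meas: "u \<in> borel_measurable N" "\<And>t. 0 \<le> u t" if "u \<in> nonneg_bounded M" for u
    using that N by (auto simp: nonneg_bounded_def cong: measurable_cong_sets)
  note int = int_weight_real_class[OF _ N ac]
  show ?thesis
    unfolding weight_def pos_cone_Linf_eq
  proof (intro conjI ballI allI impI; clarsimp)
    fix u v assume uv: "u \<in> nonneg_bounded M" "v \<in> nonneg_bounded M"
    show "int_weight N (real_class M u \<oplus>\<^bsub>Linf M\<^esub> real_class M v) =
        int_weight N (real_class M u) + int_weight N (real_class M v)"
      using uv meas[OF uv(1)] meas[OF uv(2)]
      by (simp add: add_real_class int nonneg_bounded_add nn_integral_add)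
  next
    fix c :: real and u assume cu: "0 \<le> c" "u \<in> nonneg_bounded M"
    show "int_weight N (complex_of_real c \<odot>\<^bsub>Linf M\<^esub> real_class M u) =
        ennreal c * int_weight N (real_class M u)"
      using cu meas[OF cu(2)]
      by (simp add: smult_real_class int nonneg_bounded_mult ennreal_mult nn_integral_cmult)
  qed
qed

lemma has_density_imp_normal_weight:
  assumes sf: "semifinite M" and N: "sets N = sets M" and h: "has_density M N h"
  shows "normal_weight (Linf M) (int_weight N)"
  unfolding normal_weight_def
proof (intro conjI allI impI)
  have hm: "h \<in> borel_measurable M" and dens: "density M h = N"
    using h has_density_iff[OF N] by auto
  have ac: "absolutely_continuous M N" by (rule has_density_imp_absolutely_continuous[OF h N])
  show "weight (Linf M) (int_weight N)" by (rule weight_int_weight[OF N ac])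
  fix I :: "('a \<Rightarrow> complex) set set" and r x s
  assume net: "increasing_net (pos_order (Linf M)) I r x"
    and lst: "least (pos_order (Linf M)) s (Upper (pos_order (Linf M)) (x ` I))"
  have "x ` I \<subseteq> real_class M ` nonneg_bounded M"
    using net by (simp add: increasing_net_def pos_order_def pos_cone_Linf_eq)
  then have "\<forall>i\<in>I. \<exists>u. u \<in> nonneg_bounded M \<and> x i = real_class M u" by auto
  then obtain v where "\<forall>i\<in>I. v i \<in> nonneg_bounded M \<and> x i = real_class M (v i)"
    by (rule bchoice[THEN exE])
  then have v: "\<And>i. i \<in> I \<Longrightarrow> v i \<in> nonneg_bounded M" and xv: "\<And>i. i \<in> I \<Longrightarrow> x i = real_class M (v i)"
    by blast+
  have "s \<in> real_class M ` nonneg_bounded M"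
    using lst by (auto simp: least_def Upper_def pos_order_def pos_cone_Linf_eq)
  then obtain u where u: "u \<in> nonneg_bounded M" "s = real_class M u" by blast
  have "increasing_net (pos_order (Linf M)) I r (\<lambda>i. real_class M (v i))"
    using net xv by (auto simp: increasing_net_def)
  then have net': "directed_index I r" "\<And>i j. i \<in> I \<Longrightarrow> j \<in> I \<Longrightarrow> r i j \<Longrightarrow> AE t in M. v i t \<le> v j t"
    using increasing_net_real_class[of I v M r] v by auto
  have "x ` I = (\<lambda>i. real_class M (v i)) ` I" using xv by auto
  then have "least (pos_order (Linf M)) (real_class M u)
      (Upper (pos_order (Linf M)) ((\<lambda>i. real_class M (v i)) ` I))"
    using lst u by simp
  then have L: "(\<forall>i\<in>I. AE t in M. v i t \<le> u t) \<and>
      (\<forall>w\<in>nonneg_bounded M. (\<forall>i\<in>I. AE t in M. v i t \<le> w t) \<longrightarrow> (AE t in M. u t \<le> w t))"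
    by (rule least_Upper_real_class[THEN iffD1, rotated 2]) (use v u in auto)
  have lst': "\<And>i. i \<in> I \<Longrightarrow> AE t in M. v i t \<le> u t"
    "\<And>w. w \<in> nonneg_bounded M \<Longrightarrow> (\<And>i. i \<in> I \<Longrightarrow> AE t in M. v i t \<le> w t) \<Longrightarrow> AE t in M. u t \<le> w t"
    using conjunct1[OF L] conjunct2[OF L] by simp_all
  have "(\<integral>\<^sup>+t. ennreal (u t) \<partial>N) = (SUP i\<in>I. \<integral>\<^sup>+t. ennreal (v i t) \<partial>N)"
    unfolding dens[symmetric]
    by (rule nn_integral_density_least_upper_bound[OF sf hm net'(1) v net'(2) u(1) lst'])
  then show "int_weight N s = (SUP i\<in>I. int_weight N (x i))"
    using u v xv by (simp add: int_weight_real_class[OF _ N ac] cong: SUP_cong)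
qed

text \<open>By semifiniteness \<open>\<chi>\<^sub>E\<close> is the supremum of the net of all \<open>\<chi>\<^sub>F\<close> with \<open>F \<subseteq> E\<close> of finite
  measure.\<close>

lemma normal_weight_imp_rel_semifinite:
  assumes sf: "semifinite M" and N: "sets N = sets M" and ac: "absolutely_continuous M N"
    and norm: "normal_weight (Linf M) (int_weight N)"
  shows "rel_semifinite M N"
  unfolding rel_semifinite_def
proof (intro ballI impI)
  fix E assume E: "E \<in> sets M" "0 < emeasure N E"
  define I where "I = {F \<in> sets M. F \<subseteq> E \<and> emeasure M F < \<infinity>}"
  have ind: "(indicator F :: 'a \<Rightarrow> real) \<in> nonneg_bounded M" if "F \<in> I" for F
    using that by (intro nonneg_bounded_indicator) (simp add: I_def)
  have dir: "directed_index I (\<subseteq>)"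
    unfolding I_def by (rule directed_finite_measure_subsets)
  have net: "increasing_net (pos_order (Linf M)) I (\<subseteq>) (\<lambda>F. real_class M (indicator F))"
    using dir by (subst increasing_net_real_class) (auto simp: ind split: split_indicator)
  have "least (pos_order (Linf M)) (real_class M (indicator E))
      (Upper (pos_order (Linf M)) ((\<lambda>F. real_class M (indicator F)) ` I))"
  proof (subst least_Upper_real_class[OF ind nonneg_bounded_indicator[OF E(1)]]; (intro conjI ballI impI)?)
    show "AE t in M. (indicator F t :: real) \<le> indicator E t" if "F \<in> I" for F
      using that by (auto simp: I_def split: split_indicator)
    fix w assume w: "w \<in> nonneg_bounded M" "\<forall>F\<in>I. AE t in M. indicator F t \<le> w t"
    have [measurable]: "w \<in> borel_measurable M" "E \<in> sets M"
      using w E by (auto simp: nonneg_bounded_def)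
    \<comment> \<open>\<open>D\<close> is where \<open>w\<close> fails to dominate the indicator of
      \<open>E\<close>. A non-null \<open>D\<close> would contain a non-null member of
      \<open>I\<close>, on which \<open>w\<close> must be at least 1.\<close>
    define D where "D = {t \<in> space M. t \<in> E \<and> w t < 1}"
    have D: "D \<in> sets M" unfolding D_def by measurable
    have "emeasure M D = 0"
    proof (rule ccontr)
      assume "emeasure M D \<noteq> 0"
      from semifinite_obtain[OF sf D this] obtain F where
        F: "F \<in> sets M" "F \<subseteq> D" "0 < emeasure M F" "emeasure M F < \<infinity>" .
      then have "F \<in> I" by (auto simp: I_def D_def)
      with w have "AE t in M. indicator F t \<le> w t" by blast
      then have "AE t in M. t \<notin> F"
        by eventually_elim (use F(2) in \<open>auto simp: D_def indicator_def split: if_splits\<close>)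
      then have "F \<in> null_sets M" using F(1) by (simp add: AE_iff_null_sets)
      then show False using F(3) by auto
    qed
    moreover have "indicator E t \<le> w t" if "t \<in> space M" "t \<notin> D" for t
      using that w(1) by (auto simp: D_def nonneg_bounded_def split: split_indicator)
    ultimately show "AE t in M. indicator E t \<le> w t"
      using D by (intro AE_I[of _ _ D]) auto
  qed auto
  from normal_weight_any_net[OF partial_order_pos_order_Linf norm net this]
  have "int_weight N (real_class M (indicator E)) =
      (SUP F\<in>I. int_weight N (real_class M (indicator F)))" .
  moreover have "int_weight N (real_class M (indicator F)) = emeasure N F" if "F \<in> sets M" for F
    using that N by (simp add: int_weight_real_class[OF _ N ac] nonneg_bounded_indicator
        ennreal_indicator)
  moreover from this have "(SUP F\<in>I. int_weight N (real_class M (indicator F))) = (SUP F\<in>I. emeasure N F)"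
    by (intro SUP_cong) (auto simp: I_def)
  ultimately have "emeasure N E = (SUP F\<in>I. emeasure N F)"
    using E(1) by simp
  with E(2) obtain F where "F \<in> I" "0 < emeasure N F"
    by (auto simp: less_SUP_iff)
  then show "\<exists>F\<in>sets M. F \<subseteq> E \<and> emeasure M F < \<infinity> \<and> 0 < emeasure N F"
    by (auto simp: I_def)
qed

section \<open>Every normal weight is integration against a measure\<close>

text \<open>For a sequence the pointwise limit is the least upper bound in the algebra, because
  countably many almost-everywhere inequalities hold simultaneously.\<close>

lemma normal_weight_monotone_convergence:
  fixes u :: "nat \<Rightarrow> 'a \<Rightarrow> real"
  assumes norm: "normal_weight (Linf M) \<omega>"
    and u: "\<And>n. u n \<in> nonneg_bounded M" and s: "s \<in> nonneg_bounded M"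
    and inc: "\<And>m n t. m \<le> n \<Longrightarrow> t \<in> space M \<Longrightarrow> u m t \<le> u n t"
    and lim: "\<And>t. t \<in> space M \<Longrightarrow> (\<lambda>n. u n t) \<longlonglongrightarrow> s t"
  shows "\<omega> (real_class M s) = (SUP n. \<omega> (real_class M (u n)))"
proof (rule normal_weight_any_net[OF partial_order_pos_order_Linf norm])
  show "increasing_net (pos_order (Linf M)) UNIV (\<le>) (\<lambda>n. real_class M (u n))"
    using u inc by (subst increasing_net_real_class)
      (auto simp: directed_index_def intro!: AE_I2 intro: max.cobounded1 max.cobounded2)
  show "least (pos_order (Linf M)) (real_class M s)
      (Upper (pos_order (Linf M)) (range (\<lambda>n. real_class M (u n))))"
  proof (subst least_Upper_real_class[OF u s]; (intro conjI ballI impI)?)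
    show "AE t in M. u n t \<le> s t" for n
    proof (rule AE_I2)
      fix t assume t: "t \<in> space M"
      show "u n t \<le> s t"
        by (rule incseq_le[OF _ lim[OF t]]) (use inc t in \<open>auto simp: incseq_def\<close>)
    qed
    fix w assume "\<forall>n\<in>UNIV. AE t in M. u n t \<le> w t"
    then have "AE t in M. \<forall>n. u n t \<le> w t" by (simp add: AE_all_countable)
    then show "AE t in M. s t \<le> w t"
      using AE_space
    proof eventually_elim
      case (elim t)
      then show ?case by (intro LIMSEQ_le_const2[OF lim]) auto
    qed
  qed
qed

lemma weight_real_class:
  assumes "weight (Linf M) \<omega>"
  shows "u \<in> nonneg_bounded M \<Longrightarrow> v \<in> nonneg_bounded M \<Longrightarrow>
      \<omega> (real_class M (\<lambda>t. u t + v t)) = \<omega> (real_class M u) + \<omega> (real_class M v)"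
    and "0 \<le> c \<Longrightarrow> u \<in> nonneg_bounded M \<Longrightarrow>
      \<omega> (real_class M (\<lambda>t. c * u t)) = ennreal c * \<omega> (real_class M u)"
  using assms unfolding weight_def pos_cone_Linf_eq
  by (auto simp: add_real_class[symmetric] smult_real_class[symmetric])

definition weight_measure :: "'a measure \<Rightarrow> (('a \<Rightarrow> complex) set \<Rightarrow> ennreal) \<Rightarrow> 'a measure" where
  "weight_measure M \<omega> = measure_of (space M) (sets M) (\<lambda>E. \<omega> (real_class M (indicator E)))"

lemma sets_weight_measure: "sets (weight_measure M \<omega>) = sets M"
  by (simp add: weight_measure_def)

lemma space_weight_measure: "space (weight_measure M \<omega>) = space M"
  by (simp add: weight_measure_def)

text \<open>Finite additivity comes from additivity of the weight on disjoint indicators; normality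
  along the partial unions upgrades it to countable additivity.\<close>

lemma emeasure_weight_measure:
  assumes norm: "normal_weight (Linf M) \<omega>" and E: "E \<in> sets M"
  shows "emeasure (weight_measure M \<omega>) E = \<omega> (real_class M (indicator E))"
proof (rule emeasure_measure_of[OF weight_measure_def])
  have w: "weight (Linf M) \<omega>" using norm by (simp add: normal_weight_def)
  define m where "m E = \<omega> (real_class M (indicator E))" for E
  \<comment> \<open>Homogeneity with factor 0 gives the value 0 without knowing beforehand that the
    weight is finite on this class.\<close>
  have "(indicator {} :: 'a \<Rightarrow> real) = (\<lambda>t. 0 * indicator {} t)" by (simp add: fun_eq_iff)
  then have m_empty: "m {} = 0"
    unfolding m_def using weight_real_class(2)[OF w, of 0 "indicator {}"] nonneg_bounded_indicator[of "{}" M]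
    by (metis ennreal_0 mult_zero_left order.refl sets.empty_sets)
  have m_Un: "m (A \<union> B) = m A + m B" if "A \<in> sets M" "B \<in> sets M" "A \<inter> B = {}" for A B
  proof -
    have "(indicator (A \<union> B) :: 'a \<Rightarrow> real) = (\<lambda>t. indicator A t + indicator B t)"
      using that(3) by (auto simp: fun_eq_iff split: split_indicator)
    then show ?thesis
      unfolding m_def using weight_real_class(1)[OF w] that nonneg_bounded_indicator by metis
  qed
  show "positive (sets (weight_measure M \<omega>)) (\<lambda>E. \<omega> (real_class M (indicator E)))"
    using m_empty by (simp add: positive_def m_def)
  have "countably_additive (sets M) m"
  proof (rule countably_additiveI)
    fix A :: "nat \<Rightarrow> 'a set" assume A: "range A \<subseteq> sets M" "disjoint_family A" "(\<Union>i. A i) \<in> sets M"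
    have fin: "(\<Union>i<n. A i) \<in> sets M" for n using A(1) by auto
    have sum: "m (\<Union>i<n. A i) = (\<Sum>i<n. m (A i))" for n
    proof (induction n)
      case (Suc n)
      have "A i \<inter> A n = {}" if "i < n" for i
        using disjoint_family_onD[OF A(2), of i n] that by simp
      then have "(\<Union>i<n. A i) \<inter> A n = {}" by blast
      then have "m ((\<Union>i<n. A i) \<union> A n) = m (\<Union>i<n. A i) + m (A n)"
        using fin A(1) by (intro m_Un) auto
      moreover have "(\<Union>i<Suc n. A i) = (\<Union>i<n. A i) \<union> A n" by (auto simp: less_Suc_eq)
      ultimately show ?case using Suc by simp
    qed (simp add: m_empty)
    have "m (\<Union>i. A i) = (SUP n. m (\<Union>i<n. A i))"
      unfolding m_def
    proof (rule normal_weight_monotone_convergence[OF norm])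
      show "indicator (\<Union>i<n. A i) \<in> nonneg_bounded M" for n
        by (rule nonneg_bounded_indicator[OF fin])
      show "indicator (\<Union>i. A i) \<in> nonneg_bounded M"
        by (rule nonneg_bounded_indicator[OF A(3)])
      show "(indicator (\<Union>i<m. A i) t :: real) \<le> indicator (\<Union>i<n. A i) t" if "m \<le> n" for m n t
        by (rule indicator_leI) (use that in \<open>auto dest: order.strict_trans2\<close>)
      show "(\<lambda>n. indicator (\<Union>i<n. A i) t :: real) \<longlonglongrightarrow> indicator (\<Union>i. A i) t" for t
        by (rule LIMSEQ_indicator_UN)
    qed
    then show "(\<Sum>i. m (A i)) = m (\<Union>i. A i)" by (simp add: sum suminf_eq_SUP)
  qed
  then show "countably_additive (sets (weight_measure M \<omega>)) (\<lambda>E. \<omega> (real_class M (indicator E)))"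
    by (simp add: sets_weight_measure m_def[abs_def])
qed (auto simp: sets_weight_measure E dest: sets.sets_into_space)

text \<open>A weight sees only classes, and the indicator of a null set lies in the zero
  class.\<close>

lemma absolutely_continuous_weight_measure:
  assumes norm: "normal_weight (Linf M) \<omega>"
  shows "absolutely_continuous M (weight_measure M \<omega>)"
  unfolding absolutely_continuous_def
proof
  fix E assume E: "E \<in> null_sets M"
  then have nb: "(indicator E :: 'a \<Rightarrow> real) \<in> nonneg_bounded M" "(indicator {} :: 'a \<Rightarrow> real) \<in> nonneg_bounded M"
    by (auto intro: nonneg_bounded_indicator)
  have "AE t in M. (indicator E t :: real) = indicator {} t"
    using AE_not_in[OF E] by eventually_elim simp
  from real_class_cong_AE[OF nb this]
  have "\<omega> (real_class M (indicator E)) = \<omega> (real_class M (indicator {}))" by (rule arg_cong)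
  then have "emeasure (weight_measure M \<omega>) E = emeasure (weight_measure M \<omega>) {}"
    using emeasure_weight_measure[OF norm, of E] emeasure_weight_measure[OF norm, of "{}"] E
    by (metis null_setsD2 sets.empty_sets)
  then show "E \<in> null_sets (weight_measure M \<omega>)"
    using E by (auto simp: null_sets_def sets_weight_measure)
qed

lemma normal_weight_eq_int_weight:
  assumes norm: "normal_weight (Linf M) \<omega>" and a: "a \<in> pos_cone (Linf M)"
  shows "\<omega> a = int_weight (weight_measure M \<omega>) a"
proof -
  have w: "weight (Linf M) \<omega>" using norm by (simp add: normal_weight_def)
  let ?N = "weight_measure M \<omega>"
  have meas: "u \<in> borel_measurable ?N \<longleftrightarrow> u \<in> borel_measurable M" for u :: "'a \<Rightarrow> real"
    by (simp add: sets_weight_measure cong: measurable_cong_sets)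
  obtain u where u: "u \<in> nonneg_bounded M" "a = real_class M u"
    using a by (auto simp: pos_cone_Linf_eq)
  have "u \<in> borel_measurable M" "\<And>t. 0 \<le> u t" using u by (auto simp: nonneg_bounded_def)
  \<comment> \<open>The induction also runs through unbounded functions, so boundedness is a premise
    inside the induction formula and must be passed down to the parts of \<open>u\<close>.\<close>
  then have "u \<in> nonneg_bounded M \<longrightarrow> \<omega> (real_class M u) = (\<integral>\<^sup>+t. ennreal (u t) \<partial>?N)"
  proof (induction u rule: borel_measurable_induct_real)
    case (set A)
    then show ?case
      by (simp add: emeasure_weight_measure[OF norm] ennreal_indicator sets_weight_measure)
  next
    case (mult u c)
    show ?case
    \<comment> \<open>Boundedness of the product yields boundedness of \<open>u\<close> only after
      division by \<open>c\<close>.\<close>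
    proof (cases "c = 0")
      case True
      then show ?thesis
        using weight_real_class(2)[OF w, of 0 "\<lambda>t. 0"] by auto
    next
      case False
      show ?thesis
      proof
        assume cu: "(\<lambda>t. c * u t) \<in> nonneg_bounded M"
        from nonneg_bounded_mult[OF this, of "1 / c"] have "u \<in> nonneg_bounded M"
          using mult.hyps(1) False by simp
        with mult show "\<omega> (real_class M (\<lambda>t. c * u t)) = (\<integral>\<^sup>+t. ennreal (c * u t) \<partial>?N)"
          by (simp add: weight_real_class(2)[OF w] ennreal_mult nn_integral_cmult meas)
      qed
    qed
  next
    case (add u v)
    show ?case
    proof
      assume "(\<lambda>t. v t + u t) \<in> nonneg_bounded M"
      then obtain C where C: "\<And>t. t \<in> space M \<Longrightarrow> v t + u t \<le> C" by (auto simp: nonneg_bounded_def)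
      have "v t \<le> C" "u t \<le> C" if "t \<in> space M" for t
        \<comment> \<open>Both summands are nonnegative, so a bound for the sum bounds each of
          them.\<close>
        using C[OF that] add.hyps(2)[of t] add.hyps(4)[of t] by linarith+
      then have "u \<in> nonneg_bounded M" "v \<in> nonneg_bounded M"
        using add by (auto simp: nonneg_bounded_def)
      with add show "\<omega> (real_class M (\<lambda>t. v t + u t)) = (\<integral>\<^sup>+t. ennreal (v t + u t) \<partial>?N)"
        by (simp add: weight_real_class(1)[OF w] nn_integral_add meas)
    qed
  next
    case (seq U)
    show ?case
    proof
      assume u: "u \<in> nonneg_bounded M"
      then obtain C where C: "\<And>t. t \<in> space M \<Longrightarrow> u t \<le> C" by (auto simp: nonneg_bounded_def)
      have mono: "U m t \<le> U n t" if "m \<le> n" for m n t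
        using seq.hyps(3) that by (auto simp: incseq_def le_fun_def)
      have le: "U n t \<le> u t" if "t \<in> space M" for n t
        by (rule incseq_le[OF _ seq.hyps(4)[OF that]]) (auto simp: incseq_def mono)
      have U: "U n \<in> nonneg_bounded M" for n
        using seq.hyps(1,2) order.trans[OF le C]
        unfolding nonneg_bounded_def by (intro CollectI conjI allI exI[of _ C] ballI)
      have "\<omega> (real_class M u) = (SUP n. \<omega> (real_class M (U n)))"
        by (rule normal_weight_monotone_convergence[OF norm U u mono seq.hyps(4)])
      also have "\<dots> = (SUP n. \<integral>\<^sup>+t. ennreal (U n t) \<partial>?N)"
        using seq.IH U by simp
      also have "\<dots> = (\<integral>\<^sup>+t. (SUP n. ennreal (U n t)) \<partial>?N)"
      proof (rule nn_integral_monotone_convergence_SUP[symmetric])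
        show "incseq (\<lambda>n t. ennreal (U n t))"
          by (auto simp: incseq_def le_fun_def intro!: ennreal_leI mono)
        show "(\<lambda>t. ennreal (U n t)) \<in> borel_measurable ?N" for n
          using seq.hyps(1)[of n] unfolding meas[symmetric] by measurable
      qed
      also have "\<dots> = (\<integral>\<^sup>+t. ennreal (u t) \<partial>?N)"
      proof (rule nn_integral_cong)
        fix t assume "t \<in> space ?N"
        then have "(\<lambda>n. U n t) \<longlonglongrightarrow> u t" by (intro seq.hyps(4)) (simp add: space_weight_measure)
        then have "(\<lambda>n. ennreal (U n t)) \<longlonglongrightarrow> ennreal (u t)" by (rule tendsto_ennrealI)
        then show "(SUP n. ennreal (U n t)) = ennreal (u t)"
          by (intro LIMSEQ_unique[OF LIMSEQ_SUP]) (auto simp: incseq_def mono ennreal_leI)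
      qed
      finally show "\<omega> (real_class M u) = (\<integral>\<^sup>+t. ennreal (u t) \<partial>?N)" .
    qed
  qed
  with u show ?thesis
    using int_weight_real_class[OF u(1) sets_weight_measure absolutely_continuous_weight_measure[OF norm]]
    by simp
qed

text \<open>Normality involves only values on the positive cone; this transfers it from a given
  weight to the integral representing it there.\<close>

lemma normal_weight_cong:
  assumes norm: "normal_weight A \<omega>" and eq: "\<And>a. a \<in> pos_cone A \<Longrightarrow> \<omega> a = \<omega>' a"
    and weight: "weight A \<omega>'"
  shows "normal_weight A \<omega>'"
  unfolding normal_weight_def
proof (intro conjI weight allI impI)
  fix I :: "'a set" and r x s
  assume net: "increasing_net (pos_order A) I r x"
    and lst: "least (pos_order A) s (Upper (pos_order A) (x ` I))"
  have "\<omega> s = (SUP i\<in>I. \<omega> (x i))"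
    using norm net lst unfolding normal_weight_def by blast
  moreover have "s \<in> pos_cone A" using lst by (auto simp: least_def Upper_def pos_order_def)
  moreover have "x i \<in> pos_cone A" if "i \<in> I" for i
    using net that by (auto simp: increasing_net_def pos_order_def)
  ultimately show "\<omega>' s = (SUP i\<in>I. \<omega>' (x i))"
    using eq by (simp cong: SUP_cong)
qed

text \<open>The zero set of \<open>h\<close> is null for \<open>N\<close>. If that makes it null for
  \<open>M\<close>, then \<open>h\<close> may be given any positive value there, here 1. Conversely,
  a strictly positive density has zero integral only over null sets.\<close>

lemma absolutely_continuous_iff_positive_density:
  assumes N: "sets N = sets M" and h: "has_density M N h"
  shows "absolutely_continuous N M \<longleftrightarrow> (\<exists>h. has_density M N h \<and> (\<forall>t\<in>space M. 0 < h t))"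
proof
  have [measurable]: "h \<in> borel_measurable M" and dens: "density M h = N"
    using h has_density_iff[OF N] by auto
  assume ac: "absolutely_continuous N M"
  define Z where "Z = {t \<in> space M. h t = 0}"
  have Z[measurable]: "Z \<in> sets M" unfolding Z_def by measurable
  have "Z \<in> null_sets (density M h)"
    by (subst null_sets_density_iff) (auto simp: Z_def)
  then have "Z \<in> null_sets M" using ac dens by (auto simp: absolutely_continuous_def)
  then have "AE t in M. h t = (if t \<in> Z then 1 else h t)"
    by (auto elim!: AE_mp dest!: AE_not_in)
  then have "density M h = density M (\<lambda>t. if t \<in> Z then 1 else h t)"
    by (intro density_cong) auto
  then have "has_density M N (\<lambda>t. if t \<in> Z then 1 else h t)"
    unfolding has_density_iff[OF N] using dens by auto
  moreover have "\<forall>t\<in>space M. 0 < (if t \<in> Z then 1 else h t)"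
    by (auto simp: Z_def zero_less_iff_neq_zero)
  ultimately show "\<exists>h. has_density M N h \<and> (\<forall>t\<in>space M. 0 < h t)" by blast
next
  assume "\<exists>h. has_density M N h \<and> (\<forall>t\<in>space M. 0 < h t)"
  then obtain k where k: "k \<in> borel_measurable M" "density M k = N" "\<And>t. t \<in> space M \<Longrightarrow> 0 < k t"
    using has_density_iff[OF N] by blast
  show "absolutely_continuous N M"
    unfolding absolutely_continuous_def
  proof
    fix E assume "E \<in> null_sets N"
    then have E: "E \<in> sets M" "AE t in M. t \<in> E \<longrightarrow> k t = 0"
      using null_sets_density_iff[OF k(1)] k(2) by auto
    from E(2) AE_space have "AE t in M. t \<notin> E"
      by eventually_elim (use k(3) in fastforce)
    then show "E \<in> null_sets M" using E(1) by (simp add: AE_iff_null_sets)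
  qed
qed

text \<open>The implications run (i) to (ii) to (iii) to (i), with (iv) attached by (i) to (iv) to
  (iii).\<close>

theorem corollary4p5:
  fixes \<mu> \<nu> :: "'a measure"
  assumes "localizable \<mu>"
    and "sets \<nu> = sets \<mu>"
  shows
    "((\<exists>h. has_density \<mu> \<nu> h) \<longleftrightarrow> absolutely_continuous \<mu> \<nu> \<and> has_support \<mu> \<nu>) \<and>
     ((\<exists>h. has_density \<mu> \<nu> h) \<longleftrightarrow> absolutely_continuous \<mu> \<nu> \<and> rel_semifinite \<mu> \<nu>) \<and>
     ((\<exists>h. has_density \<mu> \<nu> h) \<longleftrightarrow>
        absolutely_continuous \<mu> \<nu> \<and> normal_weight (Linf \<mu>) (int_weight \<nu>)) \<and>
     (\<forall>\<omega>. normal_weight (Linf \<mu>) \<omega> \<longrightarrow>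
        (\<exists>\<rho>. sets \<rho> = sets \<mu> \<and> (\<exists>h. has_density \<mu> \<rho> h) \<and>
             (\<forall>a\<in>pos_cone (Linf \<mu>). \<omega> a = int_weight \<rho> a))) \<and>
     (\<forall>h h'. has_density \<mu> \<nu> h \<longrightarrow> has_density \<mu> \<nu> h' \<longrightarrow> (AE t in \<mu>. h t = h' t)) \<and>
     ((\<exists>h. has_density \<mu> \<nu> h) \<longrightarrow>
        (absolutely_continuous \<nu> \<mu> \<longleftrightarrow>
           (\<exists>h. has_density \<mu> \<nu> h \<and> (\<forall>t\<in>space \<mu>. 0 < h t))))"
proof -
  have sf: "semifinite \<mu>" and ded: "dedekind \<mu>"
    using assms(1) by (auto simp: localizable_def)
  have i_ac: "absolutely_continuous \<mu> N" if "sets N = sets \<mu>" "\<exists>h. has_density \<mu> N h" for N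
    using that has_density_imp_absolutely_continuous by blast
  have i_ii: "has_support \<mu> \<nu>" if "\<exists>h. has_density \<mu> \<nu> h"
    using that has_density_imp_has_support[OF _ assms(2)] by blast
  have ii_iii: "rel_semifinite \<mu> \<nu>" if "absolutely_continuous \<mu> \<nu>" "has_support \<mu> \<nu>"
    using that by (rule has_support_imp_rel_semifinite[OF sf])
  \<comment> \<open>Stated for arbitrary \<open>N\<close>, like \<open>i_ac\<close> and
    \<open>iv_iii\<close>: besides \<nu>, the step (iii) to (i) is applied to the measure built from
    a normal weight.\<close>
  have iii_i: "\<exists>h. has_density \<mu> N h"
    if "sets N = sets \<mu>" "absolutely_continuous \<mu> N" "rel_semifinite \<mu> N" for N
    using that by (rule rel_semifinite_imp_has_density[OF sf ded])
  have i_iv: "normal_weight (Linf \<mu>) (int_weight \<nu>)" if "\<exists>h. has_density \<mu> \<nu> h"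
    using that has_density_imp_normal_weight[OF sf assms(2)] by blast
  have iv_iii: "rel_semifinite \<mu> N"
    if "sets N = sets \<mu>" "absolutely_continuous \<mu> N" "normal_weight (Linf \<mu>) (int_weight N)" for N
    using that by (rule normal_weight_imp_rel_semifinite[OF sf])
  have weights: "\<exists>\<rho>. sets \<rho> = sets \<mu> \<and> (\<exists>h. has_density \<mu> \<rho> h) \<and>
      (\<forall>a\<in>pos_cone (Linf \<mu>). \<omega> a = int_weight \<rho> a)"
    if norm: "normal_weight (Linf \<mu>) \<omega>" for \<omega>
  proof (rule exI[of _ "weight_measure \<mu> \<omega>"], intro conjI ballI)
    note ac = absolutely_continuous_weight_measure[OF norm]
    have "normal_weight (Linf \<mu>) (int_weight (weight_measure \<mu> \<omega>))"
      by (rule normal_weight_cong[OF norm normal_weight_eq_int_weight[OF norm]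
            weight_int_weight[OF sets_weight_measure ac]])
    then show "\<exists>h. has_density \<mu> (weight_measure \<mu> \<omega>) h"
      using iii_i[OF sets_weight_measure ac] iv_iii[OF sets_weight_measure ac] by blast
  qed (simp_all add: sets_weight_measure normal_weight_eq_int_weight[OF norm])
  show ?thesis
    using i_ac[OF assms(2)] i_ii ii_iii iii_i[OF assms(2)] i_iv iv_iii[OF assms(2)] weights
      has_density_unique[OF sf, of \<nu>] absolutely_continuous_iff_positive_density[OF assms(2)]
    by (intro conjI allI impI iffI) blast+
qed

end
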